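(* Let $(R,\mathfrak{m})$ be a commutative Noetherian local ring of prime characteristic $p$, let $f : R \to R$, $f(r) = r^p$, be the Frobenius homomorphism, and let $R[x,f]$ be the associated Frobenius skew polynomial ring. Let $H$ be a left $R[x,f]$-module which is Artinian as an $R$-module. Then there exists a non-negative integer $e$ such that $x^e\,\Gamma_x(H) = 0$, where $\Gamma_x(H) = \{h \in H : x^j h = 0 \text{ for some positive integer } j\}$.
   Context: The skew polynomial ring $R[x,f]$ is, as a left $R$-module, freely generated by $(x^i)_{i \ge 0}$, so its elements are the polynomials $\sum_{i=0}^n r_i x^i$ with $n \ge 0$ and $r_0,\ldots,r_n \in R$; its multiplication is subject to the rule $xr = f(r)x = r^p x$ for all $r \in R$. Thus a left $R[x,f]$-module is an $R$-module $H$ with an additive map $h \mapsto xh$ satisfying $x(rh) = r^p(xh)$ for all $r\in R$, $h \in H$. The set $\Gamma_x(H)$ is an $R[x,f]$-submodule of $H$, called the $x$-torsion submodule of $H$. *)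

theory Defs
  imports "HOL-Algebra.UnivPoly" "HOL-Algebra.Ring_Divisibility" "HOL-Computational_Algebra.Primes"
begin

section \<open>Noetherian local rings of prime characteristic\<close>

locale local_ring = cring R + maximalideal m R for R (structure) and m +
  assumes unique_maximal: "maximalideal I R \<Longrightarrow> I = m"

text \<open>The same convention as for \<open>CHAR('a)\<close>: the nonnegative generator of the ideal of
  integers that annihilate the unit element.\<close>

definition ring_char :: "('a, 'b) ring_scheme \<Rightarrow> nat"
  where "ring_char R = Gcd {n. [n] \<cdot>\<^bsub>R\<^esub> \<one>\<^bsub>R\<^esub> = \<zero>\<^bsub>R\<^esub>}"

definition frobenius :: "('a, 'b) ring_scheme \<Rightarrow> nat \<Rightarrow> 'a \<Rightarrow> 'a"
  where "frobenius R p = (\<lambda>r. r [^]\<^bsub>R\<^esub> p)"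


section \<open>Skew polynomial rings\<close>

text \<open>The element \<open>\<Sum>i. r\<^sub>i x\<^sup>i\<close> is represented by its finitely supported sequence of (left)
  coefficients; \<^const>\<open>up\<close> is the set of these sequences. The rule \<open>x r = f(r) x\<close>
  gives \<open>(a x\<^sup>i)(b x\<^sup>j) = a f\<^sup>i(b) x\<^sup>i\<^sup>+\<^sup>j\<close>, whence the formula for the product.\<close>

definition skew_poly_ring :: "('a, 'b) ring_scheme \<Rightarrow> ('a \<Rightarrow> 'a) \<Rightarrow> (nat \<Rightarrow> 'a) ring"
  where "skew_poly_ring R f = \<lparr>
    carrier = up R,
    monoid.mult = (\<lambda>p q n. \<Oplus>\<^bsub>R\<^esub>i \<in> {..n}. p i \<otimes>\<^bsub>R\<^esub> (f ^^ i) (q (n - i))),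
    one = (\<lambda>i. if i = 0 then \<one>\<^bsub>R\<^esub> else \<zero>\<^bsub>R\<^esub>),
    ring.zero = (\<lambda>i. \<zero>\<^bsub>R\<^esub>),
    ring.add = (\<lambda>p q i. p i \<oplus>\<^bsub>R\<^esub> q i)\<rparr>"

definition skew_monom :: "('a, 'b) ring_scheme \<Rightarrow> 'a \<Rightarrow> nat \<Rightarrow> (nat \<Rightarrow> 'a)"
  where "skew_monom R a n = (\<lambda>i. if i = n then a else \<zero>\<^bsub>R\<^esub>)"

definition skew_const :: "('a, 'b) ring_scheme \<Rightarrow> 'a \<Rightarrow> (nat \<Rightarrow> 'a)"
  where "skew_const R a = skew_monom R a 0"

definition skew_var :: "('a, 'b) ring_scheme \<Rightarrow> (nat \<Rightarrow> 'a)"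
  where "skew_var R = skew_monom R \<one>\<^bsub>R\<^esub> 1"

definition frobenius_skew_ring :: "('a, 'b) ring_scheme \<Rightarrow> nat \<Rightarrow> (nat \<Rightarrow> 'a) ring"
  where "frobenius_skew_ring R p = skew_poly_ring R (frobenius R p)"


section \<open>Left modules and Artinian modules\<close>

text \<open>The library locale \<^locale>\<open>module\<close> requires a commutative ring of scalars; here the
  scalars form an arbitrary ring.\<close>

locale left_module = R?: ring R + M?: abelian_group M
  for R :: "('a, 'b) ring_scheme" (structure) and M :: "('a, 'h, 'c) module_scheme" (structure) +
  assumes smult_closed:
      "\<lbrakk> a \<in> carrier R; x \<in> carrier M \<rbrakk> \<Longrightarrow> a \<odot>\<^bsub>M\<^esub> x \<in> carrier M"
    and smult_l_distr:
      "\<lbrakk> a \<in> carrier R; b \<in> carrier R; x \<in> carrier M \<rbrakk> \<Longrightarrow>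
      (a \<oplus> b) \<odot>\<^bsub>M\<^esub> x = a \<odot>\<^bsub>M\<^esub> x \<oplus>\<^bsub>M\<^esub> b \<odot>\<^bsub>M\<^esub> x"
    and smult_r_distr:
      "\<lbrakk> a \<in> carrier R; x \<in> carrier M; y \<in> carrier M \<rbrakk> \<Longrightarrow>
      a \<odot>\<^bsub>M\<^esub> (x \<oplus>\<^bsub>M\<^esub> y) = a \<odot>\<^bsub>M\<^esub> x \<oplus>\<^bsub>M\<^esub> a \<odot>\<^bsub>M\<^esub> y"
    and smult_assoc1:
      "\<lbrakk> a \<in> carrier R; b \<in> carrier R; x \<in> carrier M \<rbrakk> \<Longrightarrow>
      (a \<otimes> b) \<odot>\<^bsub>M\<^esub> x = a \<odot>\<^bsub>M\<^esub> (b \<odot>\<^bsub>M\<^esub> x)"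
    and smult_one:
      "x \<in> carrier M \<Longrightarrow> \<one> \<odot>\<^bsub>M\<^esub> x = x"

text \<open>The fields \<open>mult\<close> and \<open>one\<close> of a module record carry no meaning; they are merely copied.\<close>

definition restrict_scalars :: "('a \<Rightarrow> 's) \<Rightarrow> ('s, 'h, 'c) module_scheme \<Rightarrow> ('a, 'h) module"
  where "restrict_scalars \<phi> M = \<lparr>
    carrier = carrier M, monoid.mult = monoid.mult M, one = one M, ring.zero = ring.zero M, ring.add = ring.add M,
    smult = (\<lambda>r h. \<phi> r \<odot>\<^bsub>M\<^esub> h)\<rparr>"

locale artinian_module = module R M for R (structure) and M (structure) +
  assumes descending_chain_condition:
    "\<lbrakk> \<And>n. submodule (N n) R M; \<And>n. N (Suc n) \<subseteq> N n \<rbrakk> \<Longrightarrow> \<exists>k. \<forall>n\<ge>k. N n = N k"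

definition x_torsion ::
    "('a, 'b) ring_scheme \<Rightarrow> nat \<Rightarrow> (nat \<Rightarrow> 'a, 'h, 'c) module_scheme \<Rightarrow> 'h set"
  where "x_torsion R p H = {h \<in> carrier H. \<exists>j::nat. j > 0 \<and>
    (skew_var R [^]\<^bsub>frobenius_skew_ring R p\<^esub> j) \<odot>\<^bsub>H\<^esub> h = \<zero>\<^bsub>H\<^esub>}"


section \<open>The skew polynomial ring is a ring\<close>

context ring
begin

lemma finsum_triangle:
  fixes g :: "nat \<Rightarrow> nat \<Rightarrow> 'a"
  assumes g: "\<And>i j. g i j \<in> carrier R"
  shows "(\<Oplus>j \<in> {..k}. \<Oplus>i \<in> {..j}. g i (j - i)) = (\<Oplus>j \<in> {..k}. \<Oplus>i \<in> {..k - j}. g j i)"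
proof (induct k)
  case 0
  then show ?case by (simp add: g Pi_def)
next
  case (Suc k)
  have "(\<Oplus>j \<in> {..Suc k}. \<Oplus>i \<in> {..Suc k - j}. g j i)
      = g (Suc k) 0 \<oplus> (\<Oplus>j \<in> {..k}. \<Oplus>i \<in> {..Suc k - j}. g j i)"
    by (simp add: g Pi_def)
  also have "(\<Oplus>j \<in> {..k}. \<Oplus>i \<in> {..Suc k - j}. g j i)
      = (\<Oplus>j \<in> {..k}. g j (Suc k - j) \<oplus> (\<Oplus>i \<in> {..k - j}. g j i))"
    by (rule finsum_cong') (auto simp: g Pi_def Suc_diff_le)
  also have "\<dots> = (\<Oplus>j \<in> {..k}. g j (Suc k - j)) \<oplus> (\<Oplus>j \<in> {..k}. \<Oplus>i \<in> {..k - j}. g j i)"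
    by (rule finsum_addf) (auto simp: g Pi_def)
  finally show ?case
    using Suc by (simp add: g Pi_def a_assoc)
qed

lemma ring_hom_funpow:
  assumes "f \<in> ring_hom R R"
  shows "f ^^ i \<in> ring_hom R R"
  by (induct i) (use assms in \<open>auto intro!: ring_hom_memI
      simp: ring_hom_closed ring_hom_mult ring_hom_add ring_hom_one\<close>)

lemma ring_hom_zero_self:
  assumes "f \<in> ring_hom R R"
  shows "f \<zero> = \<zero>"
  by (rule ring_hom_zero[OF assms]) (rule ring_axioms)+

lemma ring_hom_finsum_atMost:
  fixes n :: nat
  assumes f: "f \<in> ring_hom R R" and a: "\<And>i. a i \<in> carrier R"
  shows "f (\<Oplus>i \<in> {..n}. a i) = (\<Oplus>i \<in> {..n}. f (a i))"
  by (induct n) (simp_all add: Pi_def a ring_hom_closed[OF f] ring_hom_add[OF f])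

theorem skew_poly_ring_is_ring:
  assumes f: "f \<in> ring_hom R R"
  shows "ring (skew_poly_ring R f)"
proof -
  note F = ring_hom_funpow[OF f]
  note Fc = ring_hom_closed[OF F]
  note Fz = ring_hom_zero_self[OF F]
  let ?S = "skew_poly_ring R f"
  have closed: "(\<lambda>n. \<Oplus>i \<in> {..n}. p i \<otimes> (f ^^ i) (q (n - i))) \<in> up R"
    if p: "p \<in> up R" and q: "q \<in> up R" for p q
  proof
    show "(\<Oplus>i \<in> {..n}. p i \<otimes> (f ^^ i) (q (n - i))) \<in> carrier R" for n
      using p q by (intro finsum_closed) (auto simp: mem_upD Fc)
  next
    obtain n m where n: "bound \<zero> n p" and m: "bound \<zero> m q"
      using p q by blast
    have "bound \<zero> (n + m) (\<lambda>n. \<Oplus>i \<in> {..n}. p i \<otimes> (f ^^ i) (q (n - i)))"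
    proof
      fix k assume k: "n + m < k"
      have "p i \<otimes> (f ^^ i) (q (k - i)) = \<zero>" for i
      proof (cases "n < i")
        case True
        then show ?thesis using n p q by (simp add: bound.bound mem_upD Fc)
      next
        case False
        then have "q (k - i) = \<zero>" using m k by (auto intro: bound.bound)
        then show ?thesis using p by (simp add: mem_upD Fz)
      qed
      then show "(\<Oplus>i \<in> {..k}. p i \<otimes> (f ^^ i) (q (k - i))) = \<zero>" by simp
    qed
    then show "\<exists>n. bound \<zero> n (\<lambda>n. \<Oplus>i \<in> {..n}. p i \<otimes> (f ^^ i) (q (n - i)))" ..
  qed
  show ?thesis
  proof (intro ringI abelian_groupI monoidI)
    show "x \<oplus>\<^bsub>?S\<^esub> y \<in> carrier ?S" if "x \<in> carrier ?S" "y \<in> carrier ?S" for x y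
      using that by (simp add: skew_poly_ring_def up_add_closed)
    show "\<zero>\<^bsub>?S\<^esub> \<in> carrier ?S" by (auto simp: skew_poly_ring_def)
    show "\<one>\<^bsub>?S\<^esub> \<in> carrier ?S" using up_one_closed by (simp add: skew_poly_ring_def)
    show "x \<otimes>\<^bsub>?S\<^esub> y \<in> carrier ?S" if "x \<in> carrier ?S" "y \<in> carrier ?S" for x y
      using that closed by (simp add: skew_poly_ring_def)
    show "x \<oplus>\<^bsub>?S\<^esub> y \<oplus>\<^bsub>?S\<^esub> z = x \<oplus>\<^bsub>?S\<^esub> (y \<oplus>\<^bsub>?S\<^esub> z)"
      if "x \<in> carrier ?S" "y \<in> carrier ?S" "z \<in> carrier ?S" for x y z
      using that by (simp add: skew_poly_ring_def mem_upD a_assoc)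
    show "x \<oplus>\<^bsub>?S\<^esub> y = y \<oplus>\<^bsub>?S\<^esub> x" if "x \<in> carrier ?S" "y \<in> carrier ?S" for x y
      using that by (simp add: skew_poly_ring_def mem_upD a_comm)
    show "\<zero>\<^bsub>?S\<^esub> \<oplus>\<^bsub>?S\<^esub> x = x" if "x \<in> carrier ?S" for x
      using that by (simp add: skew_poly_ring_def mem_upD)
    show "\<exists>y\<in>carrier ?S. y \<oplus>\<^bsub>?S\<^esub> x = \<zero>\<^bsub>?S\<^esub>" if "x \<in> carrier ?S" for x
      using that by (intro bexI[of _ "\<lambda>i. \<ominus> x i"])
        (simp_all add: skew_poly_ring_def mem_upD l_neg up_a_inv_closed)
    show "(x \<oplus>\<^bsub>?S\<^esub> y) \<otimes>\<^bsub>?S\<^esub> z = x \<otimes>\<^bsub>?S\<^esub> z \<oplus>\<^bsub>?S\<^esub> y \<otimes>\<^bsub>?S\<^esub> z"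
      if "x \<in> carrier ?S" "y \<in> carrier ?S" "z \<in> carrier ?S" for x y z
      using that by (simp add: skew_poly_ring_def mem_upD Fc l_distr finsum_addf Pi_def)
    show "z \<otimes>\<^bsub>?S\<^esub> (x \<oplus>\<^bsub>?S\<^esub> y) = z \<otimes>\<^bsub>?S\<^esub> x \<oplus>\<^bsub>?S\<^esub> z \<otimes>\<^bsub>?S\<^esub> y"
      if "x \<in> carrier ?S" "y \<in> carrier ?S" "z \<in> carrier ?S" for x y z
      using that
      by (simp add: skew_poly_ring_def mem_upD Fc ring_hom_add[OF F] r_distr finsum_addf Pi_def)
    show "\<one>\<^bsub>?S\<^esub> \<otimes>\<^bsub>?S\<^esub> x = x" if "x \<in> carrier ?S" for x
    proof
      fix n
      have x: "x i \<in> carrier R" for i using that by (simp add: skew_poly_ring_def mem_upD)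
      have "(\<Oplus>i \<in> {..n}. (if i = 0 then \<one> else \<zero>) \<otimes> (f ^^ i) (x (n - i)))
          = (\<Oplus>i \<in> {..n}. if 0 = i then x n else \<zero>)"
        by (rule finsum_cong') (auto simp: x Fc)
      also have "\<dots> = x n"
        by (rule finsum_singleton) (auto simp: x)
      finally show "(\<one>\<^bsub>?S\<^esub> \<otimes>\<^bsub>?S\<^esub> x) n = x n" by (simp add: skew_poly_ring_def)
    qed
    show "x \<otimes>\<^bsub>?S\<^esub> \<one>\<^bsub>?S\<^esub> = x" if "x \<in> carrier ?S" for x
    proof
      fix n
      have x: "x i \<in> carrier R" for i using that by (simp add: skew_poly_ring_def mem_upD)
      have "(\<Oplus>i \<in> {..n}. x i \<otimes> (f ^^ i) (if n - i = 0 then \<one> else \<zero>))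
          = (\<Oplus>i \<in> {..n}. if n = i then x i else \<zero>)"
        by (rule finsum_cong') (auto simp: x Fz ring_hom_one[OF F])
      also have "\<dots> = x n"
        by (rule finsum_singleton) (auto simp: x)
      finally show "(x \<otimes>\<^bsub>?S\<^esub> \<one>\<^bsub>?S\<^esub>) n = x n" by (simp add: skew_poly_ring_def)
    qed
    show "x \<otimes>\<^bsub>?S\<^esub> y \<otimes>\<^bsub>?S\<^esub> z = x \<otimes>\<^bsub>?S\<^esub> (y \<otimes>\<^bsub>?S\<^esub> z)"
      if "x \<in> carrier ?S" "y \<in> carrier ?S" "z \<in> carrier ?S" for x y z
    proof
      fix n
      have c: "x i \<in> carrier R" "y i \<in> carrier R" "z i \<in> carrier R" for i
        using that by (simp_all add: skew_poly_ring_def mem_upD)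
      define g where "g i j = x i \<otimes> ((f ^^ i) (y j) \<otimes> (f ^^ (i + j)) (z (n - i - j)))" for i j
      have g: "g i j \<in> carrier R" for i j by (simp add: g_def c Fc)
      have "(\<Oplus>j \<in> {..n}. (\<Oplus>i \<in> {..j}. x i \<otimes> (f ^^ i) (y (j - i))) \<otimes> (f ^^ j) (z (n - j)))
          = (\<Oplus>j \<in> {..n}. \<Oplus>i \<in> {..j}. g i (j - i))"
      proof (rule finsum_cong')
        fix j
        have "(\<Oplus>i \<in> {..j}. x i \<otimes> (f ^^ i) (y (j - i))) \<otimes> (f ^^ j) (z (n - j))
            = (\<Oplus>i \<in> {..j}. x i \<otimes> (f ^^ i) (y (j - i)) \<otimes> (f ^^ j) (z (n - j)))"
          by (rule finsum_ldistr) (auto simp: c Fc)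
        also have "\<dots> = (\<Oplus>i \<in> {..j}. g i (j - i))"
          by (rule finsum_cong') (auto simp: g g_def c Fc m_assoc)
        finally show "(\<Oplus>i \<in> {..j}. x i \<otimes> (f ^^ i) (y (j - i))) \<otimes> (f ^^ j) (z (n - j))
            = (\<Oplus>i \<in> {..j}. g i (j - i))" .
      qed (auto simp: g)
      also have "\<dots> = (\<Oplus>j \<in> {..n}. \<Oplus>i \<in> {..n - j}. g j i)"
        by (rule finsum_triangle[OF g])
      also have "\<dots> = (\<Oplus>i \<in> {..n}. x i \<otimes>
          (f ^^ i) (\<Oplus>j \<in> {..n - i}. y j \<otimes> (f ^^ j) (z (n - i - j))))"
      proof (rule finsum_cong'[symmetric])
        fix i
        have "(f ^^ i) (\<Oplus>j \<in> {..n - i}. y j \<otimes> (f ^^ j) (z (n - i - j)))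
            = (\<Oplus>j \<in> {..n - i}. (f ^^ i) (y j \<otimes> (f ^^ j) (z (n - i - j))))"
          by (rule ring_hom_finsum_atMost[OF F]) (simp add: c Fc)
        also have "\<dots> = (\<Oplus>j \<in> {..n - i}. (f ^^ i) (y j) \<otimes> (f ^^ (i + j)) (z (n - i - j)))"
          by (rule finsum_cong') (auto simp: c Fc ring_hom_mult[OF F] funpow_add)
        finally show "x i \<otimes> (f ^^ i) (\<Oplus>j \<in> {..n - i}. y j \<otimes> (f ^^ j) (z (n - i - j)))
            = (\<Oplus>j \<in> {..n - i}. g i j)"
          by (simp add: g_def c Fc finsum_rdistr Pi_def)
      qed (auto simp: g)
      finally show "(x \<otimes>\<^bsub>?S\<^esub> y \<otimes>\<^bsub>?S\<^esub> z) n = (x \<otimes>\<^bsub>?S\<^esub> (y \<otimes>\<^bsub>?S\<^esub> z)) n"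
        by (simp add: skew_poly_ring_def)
    qed
  qed
qed

lemma skew_monom_mult:
  assumes f: "f \<in> ring_hom R R" and a: "a \<in> carrier R" and b: "b \<in> carrier R"
  shows "skew_monom R a i \<otimes>\<^bsub>skew_poly_ring R f\<^esub> skew_monom R b j
    = skew_monom R (a \<otimes> (f ^^ i) b) (i + j)"
proof
  fix n
  note F = ring_hom_funpow[OF f]
  have "(\<Oplus>k \<in> {..n}. (if k = i then a else \<zero>) \<otimes> (f ^^ k) (if n - k = j then b else \<zero>))
      = (\<Oplus>k \<in> {..n}. if i = k then (if n = i + j then a \<otimes> (f ^^ i) b else \<zero>) else \<zero>)"
    by (rule finsum_cong')
      (auto simp: a b ring_hom_closed[OF F] ring_hom_zero_self[OF F])
  also have "\<dots> = (if n = i + j then a \<otimes> (f ^^ i) b else \<zero>)"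
  proof (cases "i \<le> n")
    case True
    then show ?thesis
      by (intro finsum_singleton) (auto simp: a b ring_hom_closed[OF F])
  next
    case False
    then have "(\<Oplus>k \<in> {..n}. if i = k then (if n = i + j then a \<otimes> (f ^^ i) b else \<zero>) else \<zero>)
        = (\<Oplus>k \<in> {..n}. \<zero>)"
      by (intro finsum_cong') auto
    with False show ?thesis by simp
  qed
  finally show "(skew_monom R a i \<otimes>\<^bsub>skew_poly_ring R f\<^esub> skew_monom R b j) n
      = skew_monom R (a \<otimes> (f ^^ i) b) (i + j) n"
    by (simp add: skew_poly_ring_def skew_monom_def)
qed

corollary skew_var_mult_const:
  assumes f: "f \<in> ring_hom R R" and r: "r \<in> carrier R"
  shows "skew_var R \<otimes>\<^bsub>skew_poly_ring R f\<^esub> skew_const R r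
    = skew_const R (f r) \<otimes>\<^bsub>skew_poly_ring R f\<^esub> skew_var R"
  using r f by (simp add: skew_var_def skew_const_def skew_monom_mult ring_hom_closed)

end


section \<open>The Frobenius homomorphism\<close>

lemma (in ring) add_pow_ring_char:
  shows "[ring_char R] \<cdot> \<one> = \<zero>"
proof -
  define S where "S = {n::nat. [n] \<cdot> \<one> = \<zero>}"
  have "Gcd S \<in> S"
  proof (cases "\<exists>n>0. n \<in> S")
    case True
    define d where "d = (LEAST n. n > 0 \<and> n \<in> S)"
    have d: "d > 0" "d \<in> S"
      using LeastI_ex[of "\<lambda>n. n > 0 \<and> n \<in> S"] True by (auto simp: d_def)
    have "d dvd n" if n: "n \<in> S" for n
    proof (rule ccontr)
      assume "\<not> d dvd n"
      then have pos: "n mod d > 0" by (simp add: mod_greater_zero_iff_not_dvd)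
      have "[n] \<cdot> \<one> = [(d * (n div d))] \<cdot> \<one> \<oplus> [(n mod d)] \<cdot> \<one>"
        by (subst add.nat_pow_mult) simp_all
      also have "[(d * (n div d))] \<cdot> \<one> = [(n div d)] \<cdot> ([d] \<cdot> \<one>)"
        by (subst add.nat_pow_pow) simp_all
      also have "\<dots> = \<zero>" using d by (simp add: S_def)
      finally have "n mod d \<in> S" using n by (simp add: S_def)
      with pos have "d \<le> n mod d" unfolding d_def by (intro Least_le) auto
      with d show False by (metis mod_less_divisor not_le)
    qed
    with d have "Gcd S = d" by (auto intro!: dvd_antisym Gcd_greatest Gcd_dvd)
    with d show ?thesis by simp
  next
    case False
    then have "S \<subseteq> {0}" by auto
    then have Gcd: "Gcd S = 0" by (simp only: Gcd_0_iff)
    show ?thesis unfolding Gcd by (simp add: S_def)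
  qed
  then show ?thesis by (simp add: S_def ring_char_def)
qed

lemma (in ring) add_pow_ring_char_dvd:
  assumes "ring_char R dvd n" and x: "x \<in> carrier R"
  shows "[n] \<cdot> x = \<zero>"
proof -
  obtain k where k: "n = ring_char R * k" using assms by blast
  have "[ring_char R] \<cdot> x = ([ring_char R] \<cdot> \<one>) \<otimes> x"
    using x by (simp add: add_pow_ldistr)
  also have "\<dots> = \<zero>" using x by (simp add: add_pow_ring_char)
  finally have z: "[ring_char R] \<cdot> x = \<zero>" .
  have "[n] \<cdot> x = [k] \<cdot> ([ring_char R] \<cdot> x)"
    unfolding k by (rule add.nat_pow_pow[OF x, symmetric])
  then show ?thesis by (simp add: z)
qed

lemma (in cring) binomial_theorem:
  fixes n :: nat
  assumes a: "a \<in> carrier R" and b: "b \<in> carrier R"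
  shows "(a \<oplus> b) [^] n = (\<Oplus>k \<in> {..n}. [(n choose k)] \<cdot> (a [^] k \<otimes> b [^] (n - k)))"
proof (induct n)
  case 0
  then show ?case using a b by simp
next
  case (Suc n)
  define T where "T n k = [(n choose k)] \<cdot> (a [^] k \<otimes> b [^] (n - k))" for n k :: nat
  have T: "T n k \<in> carrier R" for n k using a b by (simp add: T_def)
  have T0: "T (Suc n) 0 = b \<otimes> T n 0" using a b by (simp add: T_def m_comm)
  have TS: "T (Suc n) (Suc k) = a \<otimes> T n k \<oplus> b \<otimes> T n (Suc k)" if k: "k \<le> n" for k
  proof -
    have 1: "a \<otimes> T n k = [(n choose k)] \<cdot> (a [^] Suc k \<otimes> b [^] (n - k))"
      using a b by (simp add: T_def add_pow_rdistr m_ac)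
    have 2: "b \<otimes> T n (Suc k) = [(n choose Suc k)] \<cdot> (a [^] Suc k \<otimes> b [^] (n - k))"
    proof (cases "k = n")
      case True
      then show ?thesis using a b by (simp add: T_def binomial_eq_0)
    next
      case False
      then have "n - k = Suc (n - Suc k)" using k by simp
      then show ?thesis using a b by (simp add: T_def add_pow_rdistr m_ac)
    qed
    show ?thesis unfolding 1 2 using a b
      by (simp add: T_def add.nat_pow_mult)
  qed
  have "(\<Oplus>k \<in> {..Suc n}. T (Suc n) k) = (\<Oplus>k \<in> {..n}. T (Suc n) (Suc k)) \<oplus> T (Suc n) 0"
    by (rule finsum_Suc2) (simp add: T)
  also have "(\<Oplus>k \<in> {..n}. T (Suc n) (Suc k)) = (\<Oplus>k \<in> {..n}. a \<otimes> T n k \<oplus> b \<otimes> T n (Suc k))"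
    by (rule finsum_cong') (auto simp: TS T a b)
  also have "\<dots> = (\<Oplus>k \<in> {..n}. a \<otimes> T n k) \<oplus> (\<Oplus>k \<in> {..n}. b \<otimes> T n (Suc k))"
    by (rule finsum_addf) (auto simp: T a b)
  also have "\<dots> \<oplus> T (Suc n) 0
      = (\<Oplus>k \<in> {..n}. a \<otimes> T n k) \<oplus> (\<Oplus>k \<in> {..Suc n}. b \<otimes> T n k)"
    by (subst finsum_Suc2) (simp_all add: T0 T a b a_assoc Pi_def)
  also have "(\<Oplus>k \<in> {..Suc n}. b \<otimes> T n k) = (\<Oplus>k \<in> {..n}. b \<otimes> T n k)"
    by (subst finsum_Suc) (simp_all add: T a b Pi_def, simp add: T_def a b binomial_eq_0)
  also have "(\<Oplus>k \<in> {..n}. a \<otimes> T n k) \<oplus> (\<Oplus>k \<in> {..n}. b \<otimes> T n k)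
      = (a \<oplus> b) \<otimes> (\<Oplus>k \<in> {..n}. T n k)"
    by (simp add: finsum_rdistr[symmetric] T a b Pi_def l_distr)
  also have "\<dots> = (a \<oplus> b) [^] Suc n"
    using Suc a b by (simp add: T_def m_comm)
  finally show ?case by (simp add: T_def)
qed

theorem (in cring) frobenius_ring_hom:
  assumes p: "prime p" and char: "ring_char R = p"
  shows "frobenius R p \<in> ring_hom R R"
proof (rule ring_hom_memI)
  fix a b assume a: "a \<in> carrier R" and b: "b \<in> carrier R"
  obtain q where q: "p = Suc (Suc q)"
    using prime_ge_2_nat[OF p] by (metis add_2_eq_Suc le_Suc_ex)
  let ?T = "\<lambda>k. [(p choose k)] \<cdot> (a [^] k \<otimes> b [^] (p - k))"
  have z: "?T (Suc k) = \<zero>" if "k \<le> q" for k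
  proof (rule add_pow_ring_char_dvd)
    show "ring_char R dvd (p choose Suc k)"
      unfolding char by (rule dvd_choose_prime) (use that q p in simp_all)
  qed (use a b in simp)
  have "(a \<oplus> b) [^] p = (\<Oplus>k \<in> {..Suc (Suc q)}. ?T k)"
    using binomial_theorem[OF a b, of p] q by simp
  also have "\<dots> = ?T p \<oplus> ((\<Oplus>k \<in> {..q}. ?T (Suc k)) \<oplus> ?T 0)"
    using a b by (subst finsum_Suc, simp add: Pi_def, subst finsum_Suc2) (simp_all add: q Pi_def)
  also have "(\<Oplus>k \<in> {..q}. ?T (Suc k)) = (\<Oplus>k \<in> {..q}. \<zero>)"
    by (rule finsum_cong') (auto simp only: z atMost_iff Pi_iff zero_closed)
  also have "?T p \<oplus> ((\<Oplus>k \<in> {..q}. \<zero>) \<oplus> ?T 0) = a [^] p \<oplus> b [^] p"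
    using a b by simp
  finally show "frobenius R p (a \<oplus> b) = frobenius R p a \<oplus> frobenius R p b"
    by (simp add: frobenius_def)
qed (simp_all add: frobenius_def nat_pow_distrib)

corollary (in cring) frobenius_skew_ring_is_ring:
  assumes "prime p" and "ring_char R = p"
  shows "ring (frobenius_skew_ring R p)"
  unfolding frobenius_skew_ring_def
  by (rule skew_poly_ring_is_ring[OF frobenius_ring_hom[OF assms]])


section \<open>Left modules over the Frobenius skew polynomial ring as modules with a Frobenius action\<close>

lemma (in ring) skew_monom_closed:
  "a \<in> carrier R \<Longrightarrow> skew_monom R a n \<in> carrier (skew_poly_ring R f)"
  unfolding skew_poly_ring_def skew_monom_def partial_object.simps
  by (intro mem_upI exI[of _ n]) auto

lemma (in ring) skew_const_ring_hom:
  assumes f: "f \<in> ring_hom R R"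
  shows "skew_const R \<in> ring_hom R (skew_poly_ring R f)"
proof (rule ring_hom_memI)
  fix a b assume ab: "a \<in> carrier R" "b \<in> carrier R"
  show "skew_const R a \<in> carrier (skew_poly_ring R f)"
    using ab by (simp add: skew_const_def skew_monom_closed)
  show "skew_const R (a \<otimes> b) = skew_const R a \<otimes>\<^bsub>skew_poly_ring R f\<^esub> skew_const R b"
    using ab f by (simp add: skew_const_def skew_monom_mult)
  show "skew_const R (a \<oplus> b) = skew_const R a \<oplus>\<^bsub>skew_poly_ring R f\<^esub> skew_const R b"
    using ab by (auto simp: skew_const_def skew_monom_def skew_poly_ring_def)
qed (auto simp: skew_const_def skew_monom_def skew_poly_ring_def)

lemma module_restrict_scalars:
  assumes R: "cring R" and M: "left_module S M" and hom: "\<phi> \<in> ring_hom R S"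
  shows "module R (restrict_scalars \<phi> M)"
proof -
  interpret M: left_module S M by fact
  show ?thesis
  proof (rule moduleI[OF R])
    show "abelian_group (restrict_scalars \<phi> M)"
      by (rule abelian_groupI)
        (auto simp: restrict_scalars_def M.M.a_ac intro: M.M.l_neg)
  qed (auto simp: restrict_scalars_def ring_hom_closed[OF hom] ring_hom_add[OF hom]
      ring_hom_mult[OF hom] ring_hom_one[OF hom] M.smult_closed M.smult_l_distr
      M.smult_r_distr M.smult_assoc1 M.smult_one)
qed

lemma frobenius_action:
  assumes R: "cring R" and p: "prime p" "ring_char R = p"
    and H: "left_module (frobenius_skew_ring R p) H"
    and r: "r \<in> carrier R" and h: "h \<in> carrier H"
  shows "skew_var R \<odot>\<^bsub>H\<^esub> (skew_const R r \<odot>\<^bsub>H\<^esub> h)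
    = skew_const R (r [^]\<^bsub>R\<^esub> p) \<odot>\<^bsub>H\<^esub> (skew_var R \<odot>\<^bsub>H\<^esub> h)"
proof -
  interpret R: cring R by fact
  interpret H: left_module "frobenius_skew_ring R p" H by fact
  let ?S = "frobenius_skew_ring R p"
  note c = R.skew_monom_closed[of _ _ "frobenius R p", folded frobenius_skew_ring_def]
  have "skew_var R \<otimes>\<^bsub>?S\<^esub> skew_const R r = skew_const R (r [^]\<^bsub>R\<^esub> p) \<otimes>\<^bsub>?S\<^esub> skew_var R"
    using R.skew_var_mult_const[OF R.frobenius_ring_hom[OF p] r]
    by (simp only: frobenius_skew_ring_def frobenius_def)
  moreover have "skew_var R \<in> carrier ?S" "skew_const R r \<in> carrier ?S"
      "skew_const R (r [^]\<^bsub>R\<^esub> p) \<in> carrier ?S"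
    using r by (simp_all add: skew_var_def skew_const_def c)
  ultimately show ?thesis
    using h by (simp add: H.smult_assoc1[symmetric])
qed

end

theory Submission
  imports Defs
begin

text \<open>Write \<open>X\<close> for the action of \<open>x\<close> on \<open>H\<close>. Suppose that \<open>X\<close> is nilpotent on each element of the
  torsion submodule, but not nilpotent on it. By the descending chain condition there is a minimal
  \<open>X\<close>-stable torsion submodule \<open>G\<close> on which \<open>X\<close> is not nilpotent, so that \<open>X\<close> is nilpotent on
  every proper \<open>X\<close>-stable submodule of \<open>G\<close>. Let \<open>K\<^sub>n\<close> be the kernel of \<open>X\<^sup>n\<close> on \<open>G\<close>. These
  submodules are all proper and their union is \<open>G\<close>.

  The scalars are enlarged to the operators \<open>b\<close> that agree with a scalar \<open>r\<^sub>n \<in> R\<close> on the elements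
  killed by \<open>m\<^sup>n\<close>, for each \<open>n\<close>; these are the operators given by the \<open>m\<close>-adic completion. They
  commute, preserve all submodules, and satisfy \<open>X b = b\<^sup>p X\<close>. Hence \<open>b G\<close> is \<open>X\<close>-stable, and
  either \<open>b G = G\<close> or \<open>X\<close> is nilpotent on \<open>b G\<close>. In the second case \<open>b\<close> is nilpotent on \<open>G\<close>
  (lemma \<open>nonsurjective_imp_nilpotent\<close>), and one \<open>K\<^sub>e\<close> contains all these images
  (\<open>nonsurjective_images_bounded\<close>).

  The contradiction comes from comparing two facts about the surjective operators.

  \<^item> If \<open>b K\<^bsub>n+1\<^esub> \<subseteq> K\<^sub>n\<close>, then \<open>b\<^sup>2 G \<subseteq> K\<^sub>n\<close>, so \<open>b\<close> is not surjective
    (\<open>kernel_shift_imp_nonsurjective\<close>). Here the bound on the exponent matters: from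
    \<open>b\<^sup>2 X h \<in> K\<^sub>n\<close> and \<open>p \<ge> 2\<close> one gets \<open>X (b h) = b\<^sup>p X h \<in> K\<^sub>n\<close>.
  \<^item> For all large \<open>n\<close> there is a surjective \<open>b\<close> with \<open>b K\<^bsub>n+1\<^esub> \<subseteq> K\<^sub>n\<close>
    (\<open>kernel_shift_exists\<close>). Indeed \<open>G\<close> has a finite filtration from \<open>K\<^sub>e\<close> to \<open>G\<close> whose quotients
    have simple socle. In such a quotient every proper submodule is annihilated by an operator that
    does not annihilate the quotient itself (\<open>separation\<close>), and this operator is surjective on
    \<open>G\<close>, because its image is not contained in \<open>K\<^sub>e\<close>. So in each quotient the chain induced by the
    \<open>K\<^sub>n\<close> either reaches the top, or each of its members is annihilated by a surjective operator. The
    product of these operators over the filtration is surjective again.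

  In terms of Matlis duality, \<open>G\<close> is dual to a finitely generated module over the completion, the
  filtration corresponds to one with cyclic quotients, and the second fact says that along a
  descending chain of submodules the rank at the prime ideal of the nonsurjective operators is
  eventually constant. The separation property
  replaces the duality. Quotients are never formed: a quotient is treated as a pair of nested
  submodules.\<close>

section \<open>Submodules of an Artinian module over a Noetherian local ring\<close>

locale artinian_local_module = artinian_module R M
  for R (structure) and M (structure) +
  fixes m
  assumes local_ring: "local_ring R m"
    and noetherian_ring: "noetherian_ring R"
begin

abbreviation scale :: "'a \<Rightarrow> 'c \<Rightarrow> 'c" (infixr \<open>\<bullet>\<close> 75)
  where "r \<bullet> h \<equiv> r \<odot>\<^bsub>M\<^esub> h"

abbreviation plus :: "'c \<Rightarrow> 'c \<Rightarrow> 'c" (infixl \<open>\<boxplus>\<close> 65)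
  where "h \<boxplus> g \<equiv> h \<oplus>\<^bsub>M\<^esub> g"

abbreviation sub :: "'c set \<Rightarrow> bool"
  where "sub N \<equiv> submodule N R M"

lemma subI:
  assumes "N \<subseteq> carrier M" and "\<zero>\<^bsub>M\<^esub> \<in> N"
    and "\<And>g h. \<lbrakk>g \<in> N; h \<in> N\<rbrakk> \<Longrightarrow> g \<boxplus> h \<in> N"
    and "\<And>r h. \<lbrakk>r \<in> carrier R; h \<in> N\<rbrakk> \<Longrightarrow> r \<bullet> h \<in> N"
  shows "sub N"
proof (rule submoduleI)
  fix a assume a: "a \<in> N"
  have "\<ominus>\<^bsub>M\<^esub> a = (\<ominus> \<one>) \<bullet> a"
    using a assms(1) by (subst smult_l_minus) auto
  then show "\<ominus>\<^bsub>M\<^esub> a \<in> N" using a assms(4) by simp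
qed (use assms in auto)

lemma scale_diff:
  "\<lbrakk>r \<in> carrier R; s \<in> carrier R; h \<in> carrier M\<rbrakk> \<Longrightarrow> (r \<ominus> s) \<bullet> h = r \<bullet> h \<boxplus> (\<ominus> s) \<bullet> h"
  by (simp add: R.minus_eq smult_l_distr)

lemma sub_carrier: "sub N \<Longrightarrow> h \<in> N \<Longrightarrow> h \<in> carrier M"
  using submoduleE(1) by blast

lemma sub_add: "sub N \<Longrightarrow> g \<in> N \<Longrightarrow> h \<in> N \<Longrightarrow> g \<boxplus> h \<in> N"
  by (rule submoduleE(5))

lemma sub_scale: "sub N \<Longrightarrow> r \<in> carrier R \<Longrightarrow> h \<in> N \<Longrightarrow> r \<bullet> h \<in> N"
  by (rule submoduleE(4))

lemma sub_zero: "sub N \<Longrightarrow> \<zero>\<^bsub>M\<^esub> \<in> N"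
  using submoduleE(2)[of N] sub_scale[of N \<zero>] sub_carrier[of N] by fastforce

lemma sub_Int: "sub N \<Longrightarrow> sub L \<Longrightarrow> sub (N \<inter> L)"
  by (rule subI) (auto intro: sub_carrier sub_add sub_scale sub_zero)

lemma sub_singleton_zero: "sub {\<zero>\<^bsub>M\<^esub>}"
  by (rule subI) auto

lemma sub_add_cancel:
  assumes N: "sub N" and g: "g \<in> N" and h: "h \<in> carrier M" and gh: "g \<boxplus> h \<in> N"
  shows "h \<in> N"
proof -
  have "h = \<ominus>\<^bsub>M\<^esub> g \<boxplus> (g \<boxplus> h)"
    using sub_carrier[OF N g] h by (metis M.r_neg1)
  then show ?thesis using sub_add[OF N submoduleE(3)[OF N g] gh] by simp
qed

definition adjoin :: "'c set \<Rightarrow> 'c \<Rightarrow> 'c set"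
  where "adjoin N g = {y \<boxplus> r \<bullet> g | y r. y \<in> N \<and> r \<in> carrier R}"

lemma sub_adjoin:
  assumes N: "sub N" and g: "g \<in> carrier M"
  shows "sub (adjoin N g)"
proof (rule subI)
  show "adjoin N g \<subseteq> carrier M"
    using g by (auto simp: adjoin_def intro: sub_carrier[OF N])
  show "\<zero>\<^bsub>M\<^esub> \<in> adjoin N g"
    unfolding adjoin_def mem_Collect_eq
    by (intro exI[of _ "\<zero>\<^bsub>M\<^esub>"] exI[of _ "\<zero>"]) (use g sub_zero[OF N] in simp)
next
  fix u v assume "u \<in> adjoin N g" "v \<in> adjoin N g"
  then obtain y r z s where
    u: "u = y \<boxplus> r \<bullet> g" "y \<in> N" "r \<in> carrier R" and v: "v = z \<boxplus> s \<bullet> g" "z \<in> N" "s \<in> carrier R"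
    unfolding adjoin_def by blast
  note c = sub_carrier[OF N u(2)] sub_carrier[OF N v(2)]
  have "u \<boxplus> v = (y \<boxplus> z) \<boxplus> (r \<oplus> s) \<bullet> g"
    using u v c g by (simp add: smult_l_distr M.a_ac)
  then show "u \<boxplus> v \<in> adjoin N g"
    unfolding adjoin_def using sub_add[OF N] u v by blast
next
  fix a u assume a: "a \<in> carrier R" and "u \<in> adjoin N g"
  then obtain y r where u: "u = y \<boxplus> r \<bullet> g" "y \<in> N" "r \<in> carrier R"
    unfolding adjoin_def by blast
  have "a \<bullet> u = a \<bullet> y \<boxplus> (a \<otimes> r) \<bullet> g"
    using u a sub_carrier[OF N u(2)] g by (simp add: smult_r_distr smult_assoc1)
  then show "a \<bullet> u \<in> adjoin N g"
    unfolding adjoin_def using sub_scale[OF N] u a by blast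
qed

lemma subset_adjoin: "sub N \<Longrightarrow> g \<in> carrier M \<Longrightarrow> N \<subseteq> adjoin N g"
proof
  fix y assume N: "sub N" and g: "g \<in> carrier M" and y: "y \<in> N"
  then have "y = y \<boxplus> \<zero> \<bullet> g" by (auto dest: sub_carrier)
  with y show "y \<in> adjoin N g" unfolding adjoin_def by blast
qed

lemma mem_adjoin: "sub N \<Longrightarrow> g \<in> carrier M \<Longrightarrow> g \<in> adjoin N g"
proof -
  assume N: "sub N" and g: "g \<in> carrier M"
  then have "g = \<zero>\<^bsub>M\<^esub> \<boxplus> \<one> \<bullet> g" by simp
  with sub_zero[OF N] show "g \<in> adjoin N g" unfolding adjoin_def by blast
qed

lemma adjoin_least: "sub L \<Longrightarrow> N \<subseteq> L \<Longrightarrow> g \<in> L \<Longrightarrow> adjoin N g \<subseteq> L"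
  unfolding adjoin_def by (auto intro!: sub_add sub_scale)

lemma minimal_submodule:
  assumes "P N\<^sub>0" and sub: "\<And>N. P N \<Longrightarrow> sub N"
  obtains (minimal) N where "P N" and "\<And>L. P L \<Longrightarrow> L \<subseteq> N \<Longrightarrow> L = N"
proof (rule ccontr)
  assume none: "\<not> thesis"
  have "\<exists>L. P L \<and> L \<subset> N" if N: "P N" for N
    using none N minimal by blast
  then have "\<exists>f. \<forall>n. P (f n) \<and> f (Suc n) \<subset> f n"
    using assms(1) by (intro dependent_nat_choice) auto
  then obtain f where f: "\<And>n. P (f n)" "\<And>n. f (Suc n) \<subset> f n" by blast
  have "\<exists>k. \<forall>n\<ge>k. f n = f k"
    by (rule descending_chain_condition) (use f sub in auto)
  then obtain k where "f (Suc k) = f k" by (metis le_Suc_eq le_refl)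
  with f(2)[of k] show False by simp
qed

lemma maximal_submodule_avoiding:
  assumes A: "sub A" and Y: "sub Y" and AY: "A \<subseteq> Y" and g: "g \<notin> A"
  obtains X where "sub X" "A \<subseteq> X" "X \<subseteq> Y" "g \<notin> X"
    "\<And>Z. \<lbrakk>sub Z; X \<subseteq> Z; Z \<subseteq> Y; g \<notin> Z\<rbrakk> \<Longrightarrow> Z = X"
proof -
  let ?F = "{X. sub X \<and> A \<subseteq> X \<and> X \<subseteq> Y \<and> g \<notin> X}"
  have "\<exists>X\<in>?F. \<forall>Z\<in>?F. X \<subseteq> Z \<longrightarrow> Z = X"
  proof (rule subset_Zorn_nonempty)
    show "?F \<noteq> {}" using A AY g by auto
  next
    fix \<C> assume ne: "\<C> \<noteq> {}" and ch: "subset.chain ?F \<C>"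
    have F: "X \<in> ?F" if "X \<in> \<C>" for X
      using ch that by (auto simp: subset.chain_def)
    have "sub (\<Union>\<C>)"
    proof (rule subI)
      show "\<Union>\<C> \<subseteq> carrier M" using F submoduleE(1) by blast
      show "\<zero>\<^bsub>M\<^esub> \<in> \<Union>\<C>" using ne F sub_zero by blast
      show "u \<boxplus> v \<in> \<Union>\<C>" if uv: "u \<in> \<Union>\<C>" "v \<in> \<Union>\<C>" for u v
      proof -
        obtain X Z where XZ: "X \<in> \<C>" "Z \<in> \<C>" "u \<in> X" "v \<in> Z" using uv by blast
        then have "X \<subseteq> Z \<or> Z \<subseteq> X" using ch by (auto simp: subset.chain_def)
        then obtain W where "W \<in> \<C>" "u \<in> W" "v \<in> W" using XZ by blast
        then show ?thesis using F[of W] sub_add[of W u v] by blast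
      qed
      show "r \<bullet> u \<in> \<Union>\<C>" if ru: "r \<in> carrier R" "u \<in> \<Union>\<C>" for r u
      proof -
        obtain X where "X \<in> \<C>" "u \<in> X" using ru by blast
        then show ?thesis using F[of X] sub_scale[of X r u] ru by blast
      qed
    qed
    then show "\<Union>\<C> \<in> ?F" using F ne by blast
  qed
  then obtain X where "X \<in> ?F" "\<forall>Z\<in>?F. X \<subseteq> Z \<longrightarrow> Z = X" by blast
  then show thesis by (intro that[of X]) auto
qed

lemma ideal_transporter:
  assumes A: "sub A" and Y: "Y \<subseteq> carrier M"
  shows "ideal {r \<in> carrier R. \<forall>y\<in>Y. r \<bullet> y \<in> A} R"
proof (rule idealI[OF ring_axioms])
  let ?I = "{r \<in> carrier R. \<forall>y\<in>Y. r \<bullet> y \<in> A}"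
  have Yc: "y \<in> carrier M" if "y \<in> Y" for y using that Y by blast
  show "subgroup ?I (add_monoid R)"
  proof (rule R.add.subgroupI)
    show "?I \<noteq> {}" using sub_zero[OF A] Yc by (auto intro!: exI[of _ \<zero>])
    show "\<ominus> r \<in> ?I" if "r \<in> ?I" for r
      using that Yc submoduleE(3)[OF A] by (auto simp: smult_l_minus)
    show "r \<oplus> s \<in> ?I" if "r \<in> ?I" "s \<in> ?I" for r s
      using that Yc sub_add[OF A] by (auto simp: smult_l_distr)
  qed blast
  show *: "s \<otimes> r \<in> ?I" if "r \<in> ?I" "s \<in> carrier R" for r s
    using that Yc sub_scale[OF A] by (auto simp: smult_assoc1)
  show "r \<otimes> s \<in> ?I" if "r \<in> ?I" "s \<in> carrier R" for r s
    using *[OF that] that by (simp add: m_comm)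
qed

lemma ideal_m: "ideal m R"
  using local_ring unfolding local_ring_def maximalideal_def by blast

lemma m_carrier: "r \<in> m \<Longrightarrow> r \<in> carrier R"
  using ideal.Icarr[OF ideal_m] .

text \<open>The ideal generated by a nonunit is contained in an ideal that is maximal among those avoiding
  \<open>\<one>\<close>; such an ideal is maximal, hence equal to \<open>m\<close>.\<close>

lemma unit_outside_m:
  assumes a: "a \<in> carrier R" "a \<notin> m"
  obtains t where "t \<in> carrier R" "t \<otimes> a = \<one>"
proof -
  interpret noeth: noetherian_ring R by (rule noetherian_ring)
  have "\<one> \<in> PIdl a"
  proof (rule ccontr)
    assume one: "\<one> \<notin> PIdl a"
    define F where "F = {I. ideal I R \<and> PIdl a \<subseteq> I \<and> \<one> \<notin> I}"
    have "\<exists>X\<in>F. \<forall>Z\<in>F. X \<subseteq> Z \<longrightarrow> Z = X"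
    proof (rule subset_Zorn_nonempty)
      show "F \<noteq> {}" using one cgenideal_ideal[OF a(1)] by (auto simp: F_def)
    next
      fix \<C> assume ne: "\<C> \<noteq> {}" and ch: "subset.chain F \<C>"
      then have "subset.chain {I. ideal I R} \<C>" by (auto simp: subset.chain_def F_def)
      from noeth.ideal_chain_is_trivial[OF ne this] ch
      show "\<Union>\<C> \<in> F" by (auto simp: subset.chain_def)
    qed
    then obtain X where "X \<in> F" and max: "\<And>Z. Z \<in> F \<Longrightarrow> X \<subseteq> Z \<Longrightarrow> Z = X" by blast
    then have X: "ideal X R" "PIdl a \<subseteq> X" "\<one> \<notin> X" by (simp_all add: F_def)
    have "maximalideal X R"
    proof (rule maximalidealI[OF X(1)])
      show "carrier R \<noteq> X" using X(3) by auto
      fix J assume J: "ideal J R" "X \<subseteq> J" "J \<subseteq> carrier R"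
      show "J = X \<or> J = carrier R"
      proof (cases "\<one> \<in> J")
        case True
        then show ?thesis using ideal.one_imp_carrier[OF J(1)] by simp
      next
        case False
        then have "J \<in> F" using J X(2) by (auto simp: F_def)
        then show ?thesis using max J(2) by simp
      qed
    qed
    then have "X = m" by (rule local_ring.unique_maximal[OF local_ring])
    then show False using X(2) cgenideal_self[OF a(1)] a(2) by auto
  qed
  then show thesis unfolding cgenideal_def using that by auto
qed

section \<open>Filtrations whose quotients have simple socle\<close>

text \<open>For submodules \<open>F \<subseteq> C\<close> this says that the socle of \<open>C/F\<close>, the elements killed by \<open>m\<close>, has
  dimension at most one over the residue field: each nonzero element of it generates all of it.\<close>

definition simple_socle :: "'c set \<Rightarrow> 'c set \<Rightarrow> bool"
  where "simple_socle F C \<longleftrightarrow> (\<forall>g\<in>C - F. \<forall>h\<in>C.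
    (\<forall>r\<in>m. r \<bullet> g \<in> F) \<longrightarrow> (\<forall>r\<in>m. r \<bullet> h \<in> F) \<longrightarrow> h \<in> adjoin F g)"

lemma simple_socleD:
  "\<lbrakk>simple_socle F C; g \<in> C; g \<notin> F; h \<in> C; \<And>r. r \<in> m \<Longrightarrow> r \<bullet> g \<in> F; \<And>r. r \<in> m \<Longrightarrow> r \<bullet> h \<in> F\<rbrakk>
    \<Longrightarrow> h \<in> adjoin F g"
  unfolding simple_socle_def by blast

text \<open>If \<open>X\<close> is maximal in \<open>Y\<close> with respect to avoiding \<open>g\<close>, then every nonzero submodule of \<open>Y/X\<close>
  contains the class of \<open>g\<close>. A nonzero socle element generates a simple submodule, which is
  therefore generated by \<open>g\<close> as well.\<close>

lemma maximal_avoiding_simple_socle: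
  assumes X: "sub X" and Y: "sub Y" and XY: "X \<subseteq> Y" and g: "g \<in> Y" "g \<notin> X"
    and max: "\<And>Z. \<lbrakk>sub Z; X \<subseteq> Z; Z \<subseteq> Y; g \<notin> Z\<rbrakk> \<Longrightarrow> Z = X"
  shows "simple_socle X Y"
proof -
  have *: "g \<in> adjoin X h \<and> h \<in> adjoin X g"
    if h: "h \<in> Y" "h \<notin> X" and mh: "\<And>r. r \<in> m \<Longrightarrow> r \<bullet> h \<in> X" for h
  proof -
    note hc = sub_carrier[OF Y h(1)] and gc = sub_carrier[OF Y g(1)]
    have gh: "g \<in> adjoin X h"
    proof (rule ccontr)
      assume "g \<notin> adjoin X h"
      then have "adjoin X h = X"
        using max[OF sub_adjoin[OF X hc]] subset_adjoin[OF X hc] adjoin_least[OF Y XY h(1)] by blast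
      then show False using mem_adjoin[OF X hc] h by blast
    qed
    then obtain y r where yr: "y \<in> X" "r \<in> carrier R" "g = y \<boxplus> r \<bullet> h"
      unfolding adjoin_def by blast
    have "r \<notin> m" using yr g(2) mh sub_add[OF X] by blast
    then obtain t where t: "t \<in> carrier R" "t \<otimes> r = \<one>"
      using unit_outside_m yr(2) by blast
    have "t \<bullet> g = t \<bullet> y \<boxplus> h"
      using yr t hc sub_carrier[OF X yr(1)] by (simp add: smult_r_distr smult_assoc1[symmetric])
    then have "t \<bullet> y \<boxplus> h \<in> adjoin X g"
      using sub_scale[OF sub_adjoin[OF X gc] t(1) mem_adjoin[OF X gc]] by simp
    moreover have "t \<bullet> y \<in> adjoin X g"
      using subset_adjoin[OF X gc] sub_scale[OF X t(1) yr(1)] by blast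
    ultimately have "h \<in> adjoin X g"
      using sub_add_cancel[OF sub_adjoin[OF X gc] _ hc] by blast
    with gh show ?thesis ..
  qed
  show ?thesis
    unfolding simple_socle_def
  proof (intro ballI impI)
    fix k h assume k: "k \<in> Y - X" and h: "h \<in> Y"
      and mk: "\<forall>r\<in>m. r \<bullet> k \<in> X" and mh: "\<forall>r\<in>m. r \<bullet> h \<in> X"
    have kc: "k \<in> carrier M" using k sub_carrier[OF Y] by blast
    show "h \<in> adjoin X k"
    proof (cases "h \<in> X")
      case True
      then show ?thesis using subset_adjoin[OF X kc] by blast
    next
      case False
      then have "h \<in> adjoin X g" using * h mh by blast
      moreover have "g \<in> adjoin X k" using * k mk by blast
      then have "adjoin X g \<subseteq> adjoin X k"
        by (intro adjoin_least sub_adjoin subset_adjoin X kc)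
      ultimately show ?thesis by blast
    qed
  qed
qed

text \<open>This expresses that \<open>X/A\<close> has a finite filtration whose quotients have simple socle, the dual of
  the filtration of a finitely generated module by cyclic quotients. Among the \<open>Y\<close> from which
  \<open>Q X\<close> follows there is a minimal one; were it larger than \<open>A\<close>, a submodule maximal with respect to
  avoiding some element of \<open>Y - A\<close> would be a smaller one.\<close>

lemma simple_socle_induct:
  assumes A: "sub A" and X: "sub X" and AX: "A \<subseteq> X" and base: "Q A"
    and step: "\<And>F C. \<lbrakk>sub F; sub C; A \<subseteq> F; F \<subseteq> C; C \<subseteq> X; simple_socle F C; Q F\<rbrakk> \<Longrightarrow> Q C"
  shows "Q X"
proof -
  define P where "P Y \<longleftrightarrow> sub Y \<and> A \<subseteq> Y \<and> Y \<subseteq> X \<and> (Q Y \<longrightarrow> Q X)" for Y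
  have "P X" using X AX by (simp add: P_def)
  then obtain Y where Y: "P Y" and min: "\<And>L. P L \<Longrightarrow> L \<subseteq> Y \<Longrightarrow> L = Y"
    using minimal_submodule[of P X] by (auto simp: P_def)
  note Y' = Y[unfolded P_def]
  have "Y = A"
  proof (rule ccontr)
    assume "Y \<noteq> A"
    then obtain g where g: "g \<in> Y" "g \<notin> A" using Y' by blast
    obtain Z where Z: "sub Z" "A \<subseteq> Z" "Z \<subseteq> Y" "g \<notin> Z"
      and max: "\<And>W. \<lbrakk>sub W; Z \<subseteq> W; W \<subseteq> Y; g \<notin> W\<rbrakk> \<Longrightarrow> W = Z"
      using maximal_submodule_avoiding[of A Y g] A Y' g by blast
    have "simple_socle Z Y"
      using maximal_avoiding_simple_socle[OF Z(1) _ Z(3) g(1) Z(4) max] Y' by blast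
    then have "P Z" using step[of Z Y] Z Y' by (auto simp: P_def)
    then show False using min[of Z] Z g by blast
  qed
  then show ?thesis using Y' base by blast
qed

section \<open>Elements killed by powers of the maximal ideal\<close>

text \<open>The preimage in \<open>M\<close> of the elements of \<open>M/A\<close> that are killed by \<open>m\<^sup>n\<close>.\<close>

primrec layer :: "'c set \<Rightarrow> nat \<Rightarrow> 'c set"
  where "layer A 0 = A"
  | "layer A (Suc n) = {h \<in> carrier M. \<forall>r\<in>m. r \<bullet> h \<in> layer A n}"

lemma sub_layer: "sub A \<Longrightarrow> sub (layer A n)"
proof (induct n)
  case (Suc n)
  then have L: "sub (layer A n)" by simp
  show ?case
  proof (rule subI)
    show "r \<bullet> h \<in> layer A (Suc n)" if r: "r \<in> carrier R" and h: "h \<in> layer A (Suc n)" for r h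
    proof -
      have "s \<bullet> r \<bullet> h = r \<bullet> s \<bullet> h" if "s \<in> m" for s
        using m_carrier[OF that] r h by (simp add: smult_assoc1[symmetric] m_comm)
      then show ?thesis using r h sub_scale[OF L r] by auto
    qed
  qed (auto simp: smult_r_distr m_carrier intro: sub_zero[OF L] sub_add[OF L])
qed simp

lemma layer_Suc_subset: "sub A \<Longrightarrow> layer A n \<subseteq> layer A (Suc n)"
  using sub_carrier[OF sub_layer, of A _ n] sub_scale[OF sub_layer, of A _ _ n] m_carrier by auto

lemma layer_mono: "sub A \<Longrightarrow> n \<le> k \<Longrightarrow> layer A n \<subseteq> layer A k"
  using layer_Suc_subset by (rule lift_Suc_mono_le)

lemma layer_mono_base: "A \<subseteq> B \<Longrightarrow> layer A n \<subseteq> layer B n"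
  by (induct n) auto

text \<open>Otherwise choose a minimal cyclic submodule \<open>R g\<close> whose generator is killed by no power of \<open>m\<close>.
  For \<open>r \<in> m\<close> the element \<open>r g\<close> is killed by a power of \<open>m\<close>: if not, then \<open>R r g = R g\<close> by
  minimality, so \<open>(1 - s r) g = 0\<close> with \<open>1 - s r\<close> a unit. As \<open>m\<close> is finitely generated, one power
  works for all \<open>r \<in> m\<close>, and the next power kills \<open>g\<close>.\<close>

lemma layers_exhaust:
  assumes h: "h \<in> carrier M"
  shows "\<exists>n. h \<in> layer {\<zero>\<^bsub>M\<^esub>} n"
proof (rule ccontr)
  let ?T = "layer {\<zero>\<^bsub>M\<^esub>}"
  note T = sub_layer[OF sub_singleton_zero]
  define cyc where "cyc g = {r \<bullet> g | r. r \<in> carrier R}" for g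
  have sub_cyc: "sub (cyc g)" if "g \<in> carrier M" for g
  proof -
    have "cyc g = adjoin {\<zero>\<^bsub>M\<^esub>} g" using that by (auto simp: cyc_def adjoin_def) (metis M.l_zero smult_closed)
    then show ?thesis using sub_adjoin[OF sub_singleton_zero that] by simp
  qed
  have self: "g \<in> cyc g" if "g \<in> carrier M" for g
  proof -
    have "g = \<one> \<bullet> g" using that by simp
    then show ?thesis unfolding cyc_def by blast
  qed
  define P where "P N \<longleftrightarrow> (\<exists>g\<in>carrier M. N = cyc g \<and> (\<forall>n. g \<notin> ?T n))" for N
  assume "\<nexists>n. h \<in> ?T n"
  then have "P (cyc h)" using h by (auto simp: P_def)
  then obtain N where "P N" and min: "\<And>L. P L \<Longrightarrow> L \<subseteq> N \<Longrightarrow> L = N"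
    using minimal_submodule[of P "cyc h"] sub_cyc unfolding P_def by blast
  then obtain g where g: "g \<in> carrier M" "N = cyc g" "\<And>n. g \<notin> ?T n" by (auto simp: P_def)
  have m_kill: "\<exists>n. r \<bullet> g \<in> ?T n" if r: "r \<in> m" for r
  proof (rule ccontr)
    assume n: "\<nexists>n. r \<bullet> g \<in> ?T n"
    note rc = m_carrier[OF r]
    have "P (cyc (r \<bullet> g))" using n g rc by (auto simp: P_def)
    moreover have "cyc (r \<bullet> g) \<subseteq> N"
    proof -
      have "s \<bullet> r \<bullet> g = (s \<otimes> r) \<bullet> g" if "s \<in> carrier R" for s
        using that rc g by (simp add: smult_assoc1)
      then show ?thesis using rc unfolding g(2) cyc_def by auto
    qed
    ultimately have "g \<in> cyc (r \<bullet> g)" using min self[OF g(1)] g(2) by blast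
    then obtain s where s: "s \<in> carrier R" "g = s \<bullet> r \<bullet> g" by (auto simp: cyc_def)
    have sr: "s \<otimes> r \<in> m" using ideal.I_l_closed[OF ideal_m r s(1)] .
    have "\<one> \<ominus> s \<otimes> r \<notin> m"
    proof
      assume "\<one> \<ominus> s \<otimes> r \<in> m"
      then have "(\<one> \<ominus> s \<otimes> r) \<oplus> s \<otimes> r \<in> m"
        using sr additive_subgroup.a_closed[OF ideal.axioms(1)[OF ideal_m]] by blast
      moreover have "(\<one> \<ominus> s \<otimes> r) \<oplus> s \<otimes> r = \<one>" using s rc by algebra
      ultimately have "\<one> \<in> m" by simp
      then have "carrier R = m" using ideal.one_imp_carrier[OF ideal_m] by simp
      then show False
        using local_ring maximalideal.I_notcarr unfolding local_ring_def by blast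
    qed
    then obtain t where t: "t \<in> carrier R" "t \<otimes> (\<one> \<ominus> s \<otimes> r) = \<one>"
      using unit_outside_m[of "\<one> \<ominus> s \<otimes> r"] s rc by auto
    have "g = (s \<otimes> r) \<bullet> g" using s(2) smult_assoc1[OF s(1) rc g(1)] by simp
    then have "(\<one> \<ominus> s \<otimes> r) \<bullet> g = \<zero>\<^bsub>M\<^esub>"
      using s(1) rc g(1) by (simp add: scale_diff smult_l_minus M.r_neg)
    then have "(t \<otimes> (\<one> \<ominus> s \<otimes> r)) \<bullet> g = \<zero>\<^bsub>M\<^esub>"
      using t(1) s(1) rc g(1) by (simp add: smult_assoc1)
    then have "g = \<zero>\<^bsub>M\<^esub>" using t(2) g(1) by simp
    then show False using g(3)[of 0] by simp
  qed
  obtain S where S: "S \<subseteq> carrier R" "finite S" "m = Idl S"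
    using noetherian_ring.finetely_gen[OF noetherian_ring ideal_m] by blast
  have "\<exists>n. \<forall>r\<in>S. r \<bullet> g \<in> ?T n"
  proof -
    have "\<forall>r\<in>S. \<exists>n. r \<bullet> g \<in> ?T n" using m_kill S genideal_self[OF S(1)] by blast
    then obtain f where f: "\<And>r. r \<in> S \<Longrightarrow> r \<bullet> g \<in> ?T (f r)" by metis
    have "r \<bullet> g \<in> ?T (Max (f ` S))" if "r \<in> S" for r
      using layer_mono[OF sub_singleton_zero, of "f r" "Max (f ` S)"] f[OF that] S(2) that by auto
    then show ?thesis by blast
  qed
  then obtain n where n: "\<And>r. r \<in> S \<Longrightarrow> r \<bullet> g \<in> ?T n" by blast
  have "ideal {r \<in> carrier R. r \<bullet> g \<in> ?T n} R"
    using ideal_transporter[OF T, of "{g}" n] g(1) by simp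
  then have "m \<subseteq> {r \<in> carrier R. r \<bullet> g \<in> ?T n}"
    using S n genideal_minimal[of "{r \<in> carrier R. r \<bullet> g \<in> ?T n}" S] by blast
  then have "g \<in> ?T (Suc n)" using g(1) by auto
  then show False using g(3) by blast
qed

text \<open>A submodule of \<open>M/A\<close> killed by \<open>m\<^sup>n\<close> has finite length, so it is reached from \<open>A\<close> by adjoining
  finitely many elements one at a time, each killed by \<open>m\<close> modulo its predecessors. For a module
  killed by \<open>m\<close>, a filtration with simple socles has steps generated by a single element.\<close>

lemma finite_layer_induct:
  assumes A: "sub A" and N: "sub N" "A \<subseteq> N" "N \<subseteq> layer A n" and base: "Q A"
    and step: "\<And>N' g. \<lbrakk>sub N'; A \<subseteq> N'; N' \<subseteq> N; Q N'; g \<in> N; \<And>r. r \<in> m \<Longrightarrow> r \<bullet> g \<in> N'\<rbrakk>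
      \<Longrightarrow> Q (adjoin N' g)"
  shows "Q N"
  using N step
proof (induct n arbitrary: N)
  case 0
  then have "N = A" by simp
  then show ?case using base by simp
next
  case (Suc n)
  let ?N1 = "N \<inter> layer A n"
  have sub1: "sub ?N1" using Suc.prems(1) sub_layer[OF A] by (rule sub_Int)
  have A1: "A \<subseteq> ?N1" using Suc.prems(2) layer_mono[OF A, of 0 n] by auto
  have Q1: "Q ?N1"
  proof (rule Suc.hyps[OF sub1 A1])
    show "Q (adjoin N' g)" if "sub N'" "A \<subseteq> N'" "N' \<subseteq> ?N1" "Q N'" "g \<in> ?N1" "\<And>r. r \<in> m \<Longrightarrow> r \<bullet> g \<in> N'" for N' g
      using Suc.prems(4)[of N' g] that by blast
  qed simp
  show ?case
  proof (rule simple_socle_induct[where Q = Q, OF sub1 Suc.prems(1) _ Q1])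
    fix F C assume F: "sub F" and C: "sub C" and 1: "?N1 \<subseteq> F" and FC: "F \<subseteq> C" and CN: "C \<subseteq> N"
      and soc: "simple_socle F C" and QF: "Q F"
    have mC: "r \<bullet> h \<in> F" if "r \<in> m" "h \<in> C" for r h
    proof -
      have "h \<in> layer A (Suc n)" using that CN Suc.prems(3) by blast
      moreover have "r \<bullet> h \<in> N" using that CN sub_scale[OF Suc.prems(1) m_carrier] by blast
      ultimately show ?thesis using 1 that(1) by auto
    qed
    show "Q C"
    proof (cases "C = F")
      case False
      then obtain g where g: "g \<in> C" "g \<notin> F" using FC by blast
      have "C \<subseteq> adjoin F g"
        using simple_socleD[OF soc g] mC g(1) by blast
      then have "C = adjoin F g" using adjoin_least[OF C FC g(1)] by blast
      then show ?thesis
        using Suc.prems(4)[OF F _ _ QF, of g] A1 1 FC CN g mC by blast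
    qed (use QF in simp)
  qed blast
qed

text \<open>If \<open>C/A\<close> has simple socle, a submodule of finite length is its own double annihilator. When \<open>g\<close>
  is adjoined to \<open>L\<close>, the scalars that kill \<open>L\<close> send \<open>g\<close> into the socle, and some \<open>q\<close> among them
  sends \<open>g\<close> to a generator. If every scalar killing \<open>L\<close> and \<open>g\<close> killed \<open>h\<close>, then
  \<open>q h\<close> would be \<open>t q g\<close> for some \<open>t\<close>, and every scalar killing \<open>L\<close> would kill \<open>h - t g\<close>. By
  induction \<open>h - t g \<in> L\<close>, so that \<open>h\<close> lies in \<open>L + R g\<close>.\<close>

lemma finite_separation:
  assumes A: "sub A" and C: "sub C" and soc: "simple_socle A C"
    and N: "sub N" "A \<subseteq> N" "N \<subseteq> C" "N \<subseteq> layer A n" and h: "h \<in> C" "h \<notin> N"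
  shows "\<exists>r\<in>carrier R. (\<forall>y\<in>N. r \<bullet> y \<in> A) \<and> r \<bullet> h \<notin> A"
proof -
  define kills where "kills r L \<longleftrightarrow> r \<in> carrier R \<and> (\<forall>y\<in>L. r \<bullet> y \<in> A)" for r L
  define Q where "Q L \<longleftrightarrow> (\<forall>h\<in>C - L. \<exists>r. kills r L \<and> r \<bullet> h \<notin> A)" for L
  have "Q N"
  proof (rule finite_layer_induct[OF A N(1,2,4)])
    show "Q A" unfolding Q_def
      by (intro ballI exI[of _ \<one>]) (auto simp: kills_def sub_carrier[OF A] sub_carrier[OF C])
  next
    fix L g assume L: "sub L" "A \<subseteq> L" "L \<subseteq> N" and QL: "Q L"
      and gN: "g \<in> N" and mg: "\<And>r. r \<in> m \<Longrightarrow> r \<bullet> g \<in> L"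
    have gC: "g \<in> C" using gN N by blast
    note gc = sub_carrier[OF C gC]
    have kills_adjoin: "kills r (adjoin L g)" if r: "kills r L" "r \<bullet> g \<in> A" for r
    proof -
      have "r \<bullet> (y \<boxplus> s \<bullet> g) \<in> A" if y: "y \<in> L" "s \<in> carrier R" for y s
      proof -
        have "r \<bullet> (y \<boxplus> s \<bullet> g) = r \<bullet> y \<boxplus> s \<bullet> r \<bullet> g"
          using r y sub_carrier[OF L(1) y(1)] gc
          by (simp add: kills_def smult_r_distr smult_assoc1[symmetric] m_comm)
        then show ?thesis
          using r y sub_add[OF A] sub_scale[OF A] by (simp add: kills_def)
      qed
      then show ?thesis using r by (auto simp: kills_def adjoin_def)
    qed
    show "Q (adjoin L g)" unfolding Q_def
    proof (rule ballI, rule ccontr)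
      fix h assume h: "h \<in> C - adjoin L g" and none: "\<nexists>r. kills r (adjoin L g) \<and> r \<bullet> h \<notin> A"
      have hc: "h \<in> carrier M" using h sub_carrier[OF C] by blast
      have hL: "h \<notin> L" using h subset_adjoin[OF L(1) gc] by blast
      have *: "r \<bullet> h \<in> A" if "kills r L" "r \<bullet> g \<in> A" for r
        using none kills_adjoin that by blast
      have gL: "g \<notin> L"
      proof
        assume "g \<in> L"
        then have "r \<bullet> h \<in> A" if "kills r L" for r using * that by (auto simp: kills_def)
        then show False using QL h hL by (auto simp: Q_def)
      qed
      obtain q where q: "kills q L" "q \<bullet> g \<notin> A" using QL gC gL by (auto simp: Q_def)
      then have qR: "q \<in> carrier R" by (simp add: kills_def)
      have mkill: "s \<bullet> r \<bullet> g \<in> A" if "s \<in> m" "kills r L" for s r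
      proof -
        have "s \<bullet> r \<bullet> g = r \<bullet> s \<bullet> g"
          using that m_carrier gc by (simp add: kills_def smult_assoc1[symmetric] m_comm)
        then show ?thesis using mg that by (auto simp: kills_def)
      qed
      have mqh: "s \<bullet> q \<bullet> h \<in> A" if s: "s \<in> m" for s
      proof -
        have "kills (s \<otimes> q) L"
          using q(1) m_carrier[OF s] sub_carrier[OF L(1)] sub_scale[OF A]
          by (auto simp: kills_def smult_assoc1)
        moreover have "(s \<otimes> q) \<bullet> g \<in> A"
          using mkill[OF s q(1)] m_carrier[OF s] qR gc by (simp add: smult_assoc1)
        ultimately have "(s \<otimes> q) \<bullet> h \<in> A" by (rule *)
        then show ?thesis using m_carrier[OF s] qR hc by (simp add: smult_assoc1)
      qed
      have qg: "q \<bullet> g \<in> C" using sub_scale[OF C qR gC] .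
      have qh: "q \<bullet> h \<in> C" using sub_scale[OF C qR] h by blast
      have "q \<bullet> h \<in> adjoin A (q \<bullet> g)"
        using simple_socleD[OF soc qg q(2) qh mkill[OF _ q(1)] mqh] .
      then obtain a t where at: "a \<in> A" "t \<in> carrier R" "q \<bullet> h = a \<boxplus> t \<bullet> q \<bullet> g"
        unfolding adjoin_def by blast
      \<comment> \<open>The correction of \<open>h\<close> for which \<open>q h' \<in> A\<close>.\<close>
      define h' where "h' = h \<boxplus> (\<ominus> t) \<bullet> g"
      have h'C: "h' \<in> C" unfolding h'_def
        using h at gC by (intro sub_add[OF C] sub_scale[OF C]) auto
      have "h' \<notin> L"
      proof
        assume "h' \<in> L"
        moreover have "h = h' \<boxplus> t \<bullet> g"
          using hc gc at(2) by (simp add: h'_def M.a_assoc smult_l_minus M.l_neg)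
        ultimately show False using h at(2) unfolding adjoin_def by blast
      qed
      then obtain r where r: "kills r L" "r \<bullet> h' \<notin> A" using QL h'C by (auto simp: Q_def)
      then have rR: "r \<in> carrier R" by (simp add: kills_def)
      have "r \<bullet> g \<in> adjoin A (q \<bullet> g)"
        using simple_socleD[OF soc qg q(2) sub_scale[OF C rR gC] mkill[OF _ q(1)] mkill[OF _ r(1)]] .
      then obtain a' u where au: "a' \<in> A" "u \<in> carrier R" "r \<bullet> g = a' \<boxplus> u \<bullet> q \<bullet> g"
        unfolding adjoin_def by blast
      note ac = sub_carrier[OF A at(1)] and a'c = sub_carrier[OF A au(1)]
      \<comment> \<open>The scalar \<open>v\<close> agrees with \<open>r\<close> modulo \<open>q\<close> and kills \<open>g\<close> modulo \<open>A\<close>.\<close>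
      define v where "v = r \<ominus> u \<otimes> q"
      have vR: "v \<in> carrier R" using rR qR au by (simp add: v_def)
      have v: "v \<bullet> y = r \<bullet> y \<boxplus> (\<ominus> u) \<bullet> q \<bullet> y" if "y \<in> carrier M" for y
        using that rR qR au(2) by (simp add: v_def scale_diff smult_l_minus smult_assoc1)
      have "kills v L"
        using q(1) r(1) vR au(2) sub_add[OF A] sub_scale[OF A] sub_carrier[OF L(1)]
        by (auto simp: kills_def v)
      moreover have "v \<bullet> g = a'"
        using v[OF gc] au a'c qR gc by (simp add: M.a_assoc smult_l_minus M.r_neg)
      ultimately have vh: "v \<bullet> h \<in> A" using * au(1) by blast
      have "r \<bullet> h = v \<bullet> h \<boxplus> u \<bullet> q \<bullet> h"
        using v[OF hc] rR qR hc au(2) by (simp add: M.a_assoc smult_l_minus M.l_neg)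
      also have "u \<bullet> q \<bullet> h = u \<bullet> a \<boxplus> t \<bullet> u \<bullet> q \<bullet> g"
        using at au(2) ac gc qR by (simp add: smult_r_distr smult_assoc1[symmetric] m_ac)
      finally have rh: "r \<bullet> h = v \<bullet> h \<boxplus> (u \<bullet> a \<boxplus> t \<bullet> u \<bullet> q \<bullet> g)" .
      have "r \<bullet> h' = r \<bullet> h \<boxplus> (\<ominus> t) \<bullet> r \<bullet> g"
        unfolding h'_def using rR hc gc at(2) by (simp add: smult_r_distr smult_assoc1[symmetric] m_comm)
      also have "\<dots> = v \<bullet> h \<boxplus> (u \<bullet> a \<boxplus> ((t \<bullet> u \<bullet> q \<bullet> g) \<boxplus> ((\<ominus> t) \<bullet> u \<bullet> q \<bullet> g \<boxplus> (\<ominus> t) \<bullet> a')))"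
        unfolding rh au(3) using vR hc au(2) ac at(2) a'c gc qR by (simp add: smult_r_distr M.a_ac)
      also have "(t \<bullet> u \<bullet> q \<bullet> g) \<boxplus> ((\<ominus> t) \<bullet> u \<bullet> q \<bullet> g \<boxplus> (\<ominus> t) \<bullet> a') = (\<ominus> t) \<bullet> a'"
        using at(2) au(2) a'c gc qR by (simp add: M.a_assoc[symmetric] smult_l_minus M.r_neg)
      finally have "r \<bullet> h' \<in> A"
        using vh at au by (simp add: sub_add[OF A] sub_scale[OF A])
      then show False using r(2) by blast
    qed
  qed
  then show ?thesis using h by (auto simp: Q_def kills_def)
qed

text \<open>The ring \<open>R\<close> modulo the annihilator of a module \<open>Z\<close> of finite length is Artinian, so the images
  of the ideals in it are eventually constant. The proof adjoins generators \<open>g\<close> to \<open>Z\<close> one at a time: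
  the multiples of \<open>g\<close> by those elements of \<open>I n\<close> that kill \<open>Z\<close> form a descending chain of
  submodules of \<open>M\<close>.\<close>

lemma ideal_chain_stabilises:
  assumes I: "\<And>n. ideal (I n) R" and dec: "\<And>n. I (Suc n) \<subseteq> I n"
  shows "\<exists>n\<^sub>0. \<forall>n\<ge>n\<^sub>0. \<forall>r\<in>I n\<^sub>0. \<exists>u\<in>I n. \<forall>h\<in>layer {\<zero>\<^bsub>M\<^esub>} k. r \<bullet> h = u \<bullet> h"
proof -
  define Q where "Q Z \<longleftrightarrow> (\<exists>n\<^sub>0. \<forall>n\<ge>n\<^sub>0. \<forall>r\<in>I n\<^sub>0. \<exists>u\<in>I n. \<forall>h\<in>Z. r \<bullet> h = u \<bullet> h)" for Z
  note Ic = ideal.Icarr[OF I]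
  note Iadd = additive_subgroup.a_closed[OF ideal.axioms(1)[OF I]]
  note Iinv = additive_subgroup.a_inv_closed[OF ideal.axioms(1)[OF I]]
  note Izero = additive_subgroup.zero_closed[OF ideal.axioms(1)[OF I]]
  have mono: "I k \<subseteq> I n" if "n \<le> k" for n k
    using dec that by (rule lift_Suc_antimono_le)
  have "Q (layer {\<zero>\<^bsub>M\<^esub>} k)"
  proof (rule finite_layer_induct[where Q = Q, OF sub_singleton_zero sub_layer[OF sub_singleton_zero] _ order_refl])
    show "{\<zero>\<^bsub>M\<^esub>} \<subseteq> layer {\<zero>\<^bsub>M\<^esub>} k" using layer_mono[OF sub_singleton_zero, of 0 k] by simp
    have "\<forall>r\<in>I 0. \<exists>u\<in>I n. \<forall>h\<in>{\<zero>\<^bsub>M\<^esub>}. r \<bullet> h = u \<bullet> h" for n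
      using Ic Izero by (intro ballI bexI[of _ \<zero>]) auto
    then show "Q {\<zero>\<^bsub>M\<^esub>}" unfolding Q_def by blast
  next
    fix Z g assume Z: "sub Z" and QZ: "Q Z" and g: "g \<in> layer {\<zero>\<^bsub>M\<^esub>} k"
    have gc: "g \<in> carrier M" using sub_carrier[OF sub_layer[OF sub_singleton_zero] g] .
    define L where "L n = {v \<bullet> g | v. v \<in> I n \<and> (\<forall>h\<in>Z. v \<bullet> h = \<zero>\<^bsub>M\<^esub>)}" for n
    have "\<exists>n\<^sub>1. \<forall>n\<ge>n\<^sub>1. L n = L n\<^sub>1"
    proof (rule descending_chain_condition)
      show "L (Suc n) \<subseteq> L n" for n using dec[of n] by (auto simp: L_def)
      show "sub (L n)" for n
      proof (rule subI)
        show "L n \<subseteq> carrier M" using Ic gc by (auto simp: L_def)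
        show "\<zero>\<^bsub>M\<^esub> \<in> L n" unfolding L_def mem_Collect_eq
          by (intro exI[of _ \<zero>]) (use gc Izero sub_carrier[OF Z] in auto)
      next
        fix a b assume "a \<in> L n" "b \<in> L n"
        then obtain v w where "a = v \<bullet> g" "v \<in> I n" "\<forall>h\<in>Z. v \<bullet> h = \<zero>\<^bsub>M\<^esub>"
          "b = w \<bullet> g" "w \<in> I n" "\<forall>h\<in>Z. w \<bullet> h = \<zero>\<^bsub>M\<^esub>" unfolding L_def by blast
        then show "a \<boxplus> b \<in> L n" unfolding L_def mem_Collect_eq
          by (intro exI[of _ "v \<oplus> w"]) (use gc Ic sub_carrier[OF Z] Iadd in \<open>auto simp: smult_l_distr\<close>)
      next
        fix r a assume r: "r \<in> carrier R" and "a \<in> L n"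
        then obtain v where "a = v \<bullet> g" "v \<in> I n" "\<forall>h\<in>Z. v \<bullet> h = \<zero>\<^bsub>M\<^esub>" unfolding L_def by blast
        then show "r \<bullet> a \<in> L n" unfolding L_def mem_Collect_eq
          by (intro exI[of _ "r \<otimes> v"])
            (use r gc Ic sub_carrier[OF Z] ideal.I_l_closed[OF I] in \<open>auto simp: smult_assoc1\<close>)
      qed
    qed
    then obtain n\<^sub>1 where n1: "\<And>n. n \<ge> n\<^sub>1 \<Longrightarrow> L n = L n\<^sub>1" by blast
    obtain n\<^sub>2 where n2: "\<And>n r. \<lbrakk>n \<ge> n\<^sub>2; r \<in> I n\<^sub>2\<rbrakk> \<Longrightarrow> \<exists>u\<in>I n. \<forall>h\<in>Z. r \<bullet> h = u \<bullet> h"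
      using QZ unfolding Q_def by blast
    define n\<^sub>0 where "n\<^sub>0 = max n\<^sub>1 n\<^sub>2"
    have "\<exists>u\<in>I n. \<forall>h\<in>adjoin Z g. r \<bullet> h = u \<bullet> h" if n: "n \<ge> n\<^sub>0" and r: "r \<in> I n\<^sub>0" for n r
    proof -
      have "r \<in> I n\<^sub>2" using r mono[of n\<^sub>2 n\<^sub>0] by (auto simp: n\<^sub>0_def)
      then obtain u where u: "u \<in> I n" "\<And>h. h \<in> Z \<Longrightarrow> r \<bullet> h = u \<bullet> h"
        using n2[of n r] n by (auto simp: n\<^sub>0_def)
      note rR = Ic[OF r] and uR = Ic[OF u(1)]
      define v where "v = r \<oplus> \<ominus> u"
      have vR: "v \<in> carrier R" using rR uR by (simp add: v_def)
      have "v \<in> I n\<^sub>0" unfolding v_def using Iadd[OF r Iinv] u(1) mono[OF n] by blast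
      moreover have "v \<bullet> h = \<zero>\<^bsub>M\<^esub>" if "h \<in> Z" for h
        using u(2)[OF that] sub_carrier[OF Z that] rR uR
        by (simp add: v_def smult_l_distr smult_l_minus M.r_neg)
      ultimately have "v \<bullet> g \<in> L n\<^sub>0" unfolding L_def by blast
      moreover have "L n\<^sub>0 = L n" using n1[of n] n1[of n\<^sub>0] n by (simp add: n\<^sub>0_def)
      ultimately have "v \<bullet> g \<in> L n" by simp
      then obtain w where w: "w \<in> I n" "v \<bullet> g = w \<bullet> g" "\<And>h. h \<in> Z \<Longrightarrow> w \<bullet> h = \<zero>\<^bsub>M\<^esub>"
        unfolding L_def by blast
      note wR = Ic[OF w(1)]
      have r_eq: "r = v \<oplus> u" using rR uR by (simp add: v_def R.a_assoc R.l_neg)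
      have rg: "r \<bullet> g = (w \<oplus> u) \<bullet> g"
        unfolding r_eq using vR uR wR gc w(2) by (simp add: smult_l_distr)
      have rZ: "r \<bullet> h = (w \<oplus> u) \<bullet> h" if "h \<in> Z" for h
        using u(2)[OF that] w(3)[OF that] uR wR sub_carrier[OF Z that] by (simp add: smult_l_distr)
      have "r \<bullet> h = (w \<oplus> u) \<bullet> h" if h: "h \<in> adjoin Z g" for h
      proof -
        obtain y s where ys: "y \<in> Z" "s \<in> carrier R" "h = y \<boxplus> s \<bullet> g"
          using h unfolding adjoin_def by blast
        have "a \<bullet> h = a \<bullet> y \<boxplus> s \<bullet> a \<bullet> g" if "a \<in> carrier R" for a
          using that ys gc sub_carrier[OF Z ys(1)]
          by (simp add: smult_r_distr smult_assoc1[symmetric] m_comm)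
        then show ?thesis using rg rZ[OF ys(1)] rR uR wR by simp
      qed
      then show ?thesis using Iadd[OF w(1) u(1)] by blast
    qed
    then show "Q (adjoin Z g)" unfolding Q_def by blast
  qed
  then show ?thesis unfolding Q_def .
qed

section \<open>Operators given by the completion\<close>

text \<open>The operators by which the \<open>m\<close>-adic completion of \<open>R\<close> acts on \<open>M\<close>.\<close>

definition limit_scalars :: "('c \<Rightarrow> 'c) set"
  where "limit_scalars = {b. \<forall>n. \<exists>r\<in>carrier R. \<forall>h\<in>layer {\<zero>\<^bsub>M\<^esub>} n. b h = r \<bullet> h}"

text \<open>For each \<open>n\<close>, let \<open>I n\<close> be the ideal of scalars that send the part of \<open>N\<close> in the \<open>n\<close>-th layer into
  \<open>A\<close>. By the finite case it contains scalars that do not send \<open>h\<close> into \<open>A\<close>. To pass to the limit,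
  restrict to the set \<open>S k\<close> of scalars whose action on the \<open>k\<close>-th layer of \<open>M\<close> comes from every
  \<open>I n\<close>. Stabilisation makes \<open>S (Suc k) \<rightarrow> S k\<close> surjective up to the action on the \<open>k\<close>-th
  layer, as in the Mittag-Leffler argument, so that a coherent sequence of scalars exists.\<close>

lemma separation:
  assumes A: "sub A" and C: "sub C" and soc: "simple_socle A C"
    and N: "sub N" "A \<subseteq> N" "N \<subseteq> C" and h: "h \<in> C" "h \<notin> N"
  obtains b where "b \<in> limit_scalars" "\<And>y. y \<in> N \<Longrightarrow> b y \<in> A" "b h \<notin> A"
proof -
  let ?T = "layer {\<zero>\<^bsub>M\<^esub>}"
  define I where "I n = {r \<in> carrier R. \<forall>y\<in>N \<inter> layer A n. r \<bullet> y \<in> A}" for n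
  have idI: "ideal (I n) R" for n
    unfolding I_def by (rule ideal_transporter[OF A]) (use submoduleE(1)[OF N(1)] in auto)
  have decI: "I (Suc n) \<subseteq> I n" for n
    using layer_Suc_subset[OF A, of n] unfolding I_def by blast
  have monoI: "I k \<subseteq> I n" if "n \<le> k" for n k
    using decI that by (rule lift_Suc_antimono_le)
  have T_A: "?T n \<subseteq> layer A n" for n
    using sub_zero[OF A] by (intro layer_mono_base) simp
  define S where "S k = {r \<in> carrier R. \<forall>n. \<exists>u\<in>I n. \<forall>y\<in>?T k. r \<bullet> y = u \<bullet> y}" for k
  have S_stable: "\<exists>n. I n \<subseteq> S k" for k
  proof -
    obtain n\<^sub>0 where n0: "\<And>n r. \<lbrakk>n \<ge> n\<^sub>0; r \<in> I n\<^sub>0\<rbrakk> \<Longrightarrow> \<exists>u\<in>I n. \<forall>y\<in>?T k. r \<bullet> y = u \<bullet> y"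
      using ideal_chain_stabilises[of I k, OF idI decI] by blast
    have "\<exists>u\<in>I n. \<forall>y\<in>?T k. r \<bullet> y = u \<bullet> y" if "r \<in> I n\<^sub>0" for r n
      using n0[of n r] monoI[of n n\<^sub>0] that by (cases "n\<^sub>0 \<le> n") auto
    then have "I n\<^sub>0 \<subseteq> S k" using ideal.Icarr[OF idI] unfolding S_def by blast
    then show ?thesis ..
  qed
  \<comment> \<open>The coherent sequence starts at a layer that contains \<open>h\<close>, so that no later term can send \<open>h\<close> into \<open>A\<close>.\<close>
  obtain k\<^sub>0 where k0: "h \<in> ?T k\<^sub>0" using layers_exhaust sub_carrier[OF C h(1)] by blast
  have start: "\<exists>s. s \<in> S k\<^sub>0 \<and> s \<bullet> h \<notin> A"
  proof -
    obtain n where n: "I n \<subseteq> S k\<^sub>0" using S_stable by blast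
    have "\<exists>r\<in>carrier R. (\<forall>y\<in>N \<inter> layer A n. r \<bullet> y \<in> A) \<and> r \<bullet> h \<notin> A"
    proof (rule finite_separation[OF A C soc])
      show "sub (N \<inter> layer A n)" by (rule sub_Int[OF N(1) sub_layer[OF A]])
      show "A \<subseteq> N \<inter> layer A n" using N(2) layer_mono[OF A, of 0 n] by auto
    qed (use N h in auto)
    then obtain r where "r \<in> I n" "r \<bullet> h \<notin> A" unfolding I_def by blast
    then show ?thesis using n by blast
  qed
  have extend: "\<exists>s'. s' \<in> S (Suc k) \<and> (\<forall>y\<in>?T k. s \<bullet> y = s' \<bullet> y)" if "s \<in> S k" for s k
  proof -
    obtain n where n: "I n \<subseteq> S (Suc k)" using S_stable by blast
    then show ?thesis using that unfolding S_def by blast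
  qed
  have "\<exists>s. \<forall>j. (s j \<in> S (k\<^sub>0 + j) \<and> (j = 0 \<longrightarrow> s j \<bullet> h \<notin> A))
      \<and> (\<forall>y\<in>?T (k\<^sub>0 + j). s j \<bullet> y = s (Suc j) \<bullet> y)"
    by (rule dependent_nat_choice) (use start extend in auto)
  then obtain s where s: "\<And>j. s j \<in> S (k\<^sub>0 + j)" "s 0 \<bullet> h \<notin> A"
    and s_eq: "\<And>j y. y \<in> ?T (k\<^sub>0 + j) \<Longrightarrow> s j \<bullet> y = s (Suc j) \<bullet> y" by blast
  have coherent: "s (j + i) \<bullet> y = s j \<bullet> y" if "y \<in> ?T (k\<^sub>0 + j)" for i j y
  proof (induct i)
    case (Suc i)
    have "y \<in> ?T (k\<^sub>0 + (j + i))"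
      using that layer_mono[OF sub_singleton_zero, of "k\<^sub>0 + j" "k\<^sub>0 + (j + i)"] by auto
    then show ?case using Suc s_eq by simp
  qed simp
  define \<kappa> where "\<kappa> y = (LEAST j. y \<in> ?T (k\<^sub>0 + j))" for y
  define b where "b y = s (\<kappa> y) \<bullet> y" for y
  have b: "b y = s j \<bullet> y" if "y \<in> ?T (k\<^sub>0 + j)" for j y
  proof -
    have "y \<in> ?T (k\<^sub>0 + \<kappa> y)" unfolding \<kappa>_def using that by (rule LeastI)
    moreover have "\<kappa> y \<le> j" unfolding \<kappa>_def using that by (rule Least_le)
    ultimately show ?thesis using coherent[of y "\<kappa> y" "j - \<kappa> y"] by (simp add: b_def)
  qed
  show thesis
  proof (rule that)
    have "b y = s n \<bullet> y" if "y \<in> ?T n" for n y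
      using that layer_mono[OF sub_singleton_zero, of n "k\<^sub>0 + n"] by (intro b) auto
    moreover have "s n \<in> carrier R" for n using s(1)[of n] by (simp add: S_def)
    ultimately show "b \<in> limit_scalars" unfolding limit_scalars_def by blast
    show "b h \<notin> A" using b[of h 0] k0 s(2) by simp
    fix y assume y: "y \<in> N"
    obtain n where n: "y \<in> ?T n" using layers_exhaust sub_carrier[OF N(1) y] by blast
    then have yT: "y \<in> ?T (k\<^sub>0 + n)"
      using layer_mono[OF sub_singleton_zero, of n "k\<^sub>0 + n"] by auto
    obtain u where u: "u \<in> I (k\<^sub>0 + n)" "\<And>z. z \<in> ?T (k\<^sub>0 + n) \<Longrightarrow> s n \<bullet> z = u \<bullet> z"
      using s(1)[of n] unfolding S_def by blast
    have "u \<bullet> y \<in> A" using u(1) y yT T_A unfolding I_def by blast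
    then show "b y \<in> A" using b[OF yT] u(2)[OF yT] by simp
  qed
qed

text \<open>All algebraic properties of these operators, and their commutation with the Frobenius action,
  involve finitely many elements at a time, where the operator is a scalar.\<close>

lemma limit_scalar_on_finite:
  assumes b: "b \<in> limit_scalars" and Y: "finite Y" "Y \<subseteq> carrier M"
  obtains r where "r \<in> carrier R" "\<And>y. y \<in> Y \<Longrightarrow> b y = r \<bullet> y"
proof -
  let ?T = "layer {\<zero>\<^bsub>M\<^esub>}"
  have "\<exists>n. Y \<subseteq> ?T n" using Y
  proof (induct Y)
    case (insert y Y)
    then obtain n k where "Y \<subseteq> ?T n" "y \<in> ?T k" using layers_exhaust by blast
    then have "insert y Y \<subseteq> ?T (max n k)"
      using layer_mono[OF sub_singleton_zero, of n "max n k"]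
        layer_mono[OF sub_singleton_zero, of k "max n k"] by auto
    then show ?case ..
  qed simp
  then obtain n where n: "Y \<subseteq> ?T n" ..
  obtain r where "r \<in> carrier R" "\<forall>h\<in>?T n. b h = r \<bullet> h"
    using b unfolding limit_scalars_def by blast
  then show thesis using that n by blast
qed

lemma limit_scalar_closed:
  assumes b: "b \<in> limit_scalars" and N: "sub N" and h: "h \<in> N"
  shows "b h \<in> N"
proof -
  obtain r where "r \<in> carrier R" "b h = r \<bullet> h"
    using limit_scalar_on_finite[OF b, of "{h}"] sub_carrier[OF N h] by blast
  then show ?thesis using sub_scale[OF N _ h] by simp
qed

lemmas limit_scalar_carrier = limit_scalar_closed[OF _ carrier_is_submodule]

lemma limit_scalar_add:
  assumes b: "b \<in> limit_scalars" and g: "g \<in> carrier M" and h: "h \<in> carrier M"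
  shows "b (g \<boxplus> h) = b g \<boxplus> b h"
proof -
  obtain r where "r \<in> carrier R" "\<And>y. y \<in> {g, h, g \<boxplus> h} \<Longrightarrow> b y = r \<bullet> y"
    by (rule limit_scalar_on_finite[OF b, of "{g, h, g \<boxplus> h}"]) (use g h in auto)
  then show ?thesis using g h by (simp add: smult_r_distr)
qed

lemma limit_scalar_scale:
  assumes b: "b \<in> limit_scalars" and s: "s \<in> carrier R" and h: "h \<in> carrier M"
  shows "b (s \<bullet> h) = s \<bullet> b h"
proof -
  obtain r where "r \<in> carrier R" "\<And>y. y \<in> {h, s \<bullet> h} \<Longrightarrow> b y = r \<bullet> y"
    by (rule limit_scalar_on_finite[OF b, of "{h, s \<bullet> h}"]) (use s h in auto)
  then show ?thesis using s h by (simp add: smult_assoc1[symmetric] m_comm)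
qed

lemma limit_scalar_zero: "b \<in> limit_scalars \<Longrightarrow> b \<zero>\<^bsub>M\<^esub> = \<zero>\<^bsub>M\<^esub>"
  using limit_scalar_closed[OF _ sub_singleton_zero] by blast

lemma limit_scalar_commute:
  assumes b: "b \<in> limit_scalars" and c: "c \<in> limit_scalars" and h: "h \<in> carrier M"
  shows "b (c h) = c (b h)"
proof -
  obtain r where r: "r \<in> carrier R" "\<And>y. y \<in> {h, c h} \<Longrightarrow> b y = r \<bullet> y"
    by (rule limit_scalar_on_finite[OF b, of "{h, c h}"]) (use h limit_scalar_carrier[OF c] in auto)
  then show ?thesis using limit_scalar_scale[OF c r(1) h] by simp
qed

lemma id_limit_scalar: "id \<in> limit_scalars"
proof -
  have "id h = \<one> \<bullet> h" if "h \<in> layer {\<zero>\<^bsub>M\<^esub>} n" for h n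
    using sub_carrier[OF sub_layer[OF sub_singleton_zero] that] by simp
  then show ?thesis unfolding limit_scalars_def by blast
qed

lemma comp_limit_scalar:
  assumes b: "b \<in> limit_scalars" and c: "c \<in> limit_scalars"
  shows "b \<circ> c \<in> limit_scalars"
  unfolding limit_scalars_def
proof (intro CollectI allI)
  fix n
  let ?T = "layer {\<zero>\<^bsub>M\<^esub>} n"
  note T = sub_layer[OF sub_singleton_zero]
  obtain r s where r: "r \<in> carrier R" "\<And>h. h \<in> ?T \<Longrightarrow> b h = r \<bullet> h"
    and s: "s \<in> carrier R" "\<And>h. h \<in> ?T \<Longrightarrow> c h = s \<bullet> h"
    using b c unfolding limit_scalars_def by blast
  have "(b \<circ> c) h = (r \<otimes> s) \<bullet> h" if "h \<in> ?T" for h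
    using r(2)[OF sub_scale[OF T s(1) that]] s(2)[OF that] r(1) s(1) sub_carrier[OF T that]
    by (simp add: smult_assoc1)
  then show "\<exists>r\<in>carrier R. \<forall>h\<in>?T. (b \<circ> c) h = r \<bullet> h" using r(1) s(1) by blast
qed

lemma funpow_limit_scalar: "b \<in> limit_scalars \<Longrightarrow> b ^^ n \<in> limit_scalars"
  by (induct n) (auto simp: id_limit_scalar comp_limit_scalar)

lemma sub_limit_scalar_image:
  assumes b: "b \<in> limit_scalars" and N: "sub N"
  shows "sub (b ` N)"
proof (rule subI)
  show "b ` N \<subseteq> carrier M"
    using limit_scalar_closed[OF b N] sub_carrier[OF N] by blast
  show "\<zero>\<^bsub>M\<^esub> \<in> b ` N" using limit_scalar_zero[OF b] sub_zero[OF N] by (metis imageI)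
next
  fix u v assume "u \<in> b ` N" "v \<in> b ` N"
  then obtain g h where gh: "g \<in> N" "h \<in> N" "u = b g" "v = b h" by blast
  then have "u \<boxplus> v = b (g \<boxplus> h)" using limit_scalar_add[OF b] sub_carrier[OF N] by simp
  then show "u \<boxplus> v \<in> b ` N" using sub_add[OF N gh(1,2)] by simp
next
  fix r u assume r: "r \<in> carrier R" and "u \<in> b ` N"
  then obtain h where h: "h \<in> N" "u = b h" by blast
  then have "r \<bullet> u = b (r \<bullet> h)" using limit_scalar_scale[OF b r] sub_carrier[OF N] by simp
  then show "r \<bullet> u \<in> b ` N" using sub_scale[OF N r h(1)] by simp
qed

lemma sub_limit_scalar_preimage:
  assumes b: "b \<in> limit_scalars" and N: "sub N" and K: "sub K"
  shows "sub {h \<in> N. b h \<in> K}"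
  by (rule subI)
    (auto simp: limit_scalar_add[OF b] limit_scalar_scale[OF b] limit_scalar_zero[OF b]
      sub_carrier[OF N] intro: sub_add[OF N] sub_add[OF K] sub_scale[OF N] sub_scale[OF K]
      sub_zero[OF N] sub_zero[OF K])

lemma sub_sum:
  assumes F: "sub F" and K: "sub K"
  shows "sub {f \<boxplus> k | f k. f \<in> F \<and> k \<in> K}" (is "sub ?S")
proof (rule subI)
  note Fc = sub_carrier[OF F] and Kc = sub_carrier[OF K]
  show "?S \<subseteq> carrier M" using Fc Kc by auto
  show "\<zero>\<^bsub>M\<^esub> \<in> ?S" using sub_zero[OF F] sub_zero[OF K] by (intro CollectI exI[of _ "\<zero>\<^bsub>M\<^esub>"]) simp
next
  fix u v assume "u \<in> ?S" "v \<in> ?S"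
  then obtain f k f' k' where *: "f \<in> F" "k \<in> K" "f' \<in> F" "k' \<in> K" "u = f \<boxplus> k" "v = f' \<boxplus> k'" by blast
  then have "u \<boxplus> v = (f \<boxplus> f') \<boxplus> (k \<boxplus> k')"
    by (simp add: M.a_ac sub_carrier[OF F] sub_carrier[OF K])
  then show "u \<boxplus> v \<in> ?S" using * sub_add[OF F] sub_add[OF K] by blast
next
  fix r u assume r: "r \<in> carrier R" and "u \<in> ?S"
  then obtain f k where *: "f \<in> F" "k \<in> K" "u = f \<boxplus> k" by blast
  then have "r \<bullet> u = r \<bullet> f \<boxplus> r \<bullet> k"
    using r by (simp add: smult_r_distr sub_carrier[OF F] sub_carrier[OF K])
  then show "r \<bullet> u \<in> ?S" using * sub_scale[OF F r] sub_scale[OF K r] by blast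
qed

end

section \<open>Frobenius actions\<close>

locale frobenius_module = artinian_local_module R M m
  for R (structure) and M (structure) and m +
  fixes X and p :: nat
  assumes X_closed: "h \<in> carrier M \<Longrightarrow> X h \<in> carrier M"
    and X_add: "\<lbrakk>g \<in> carrier M; h \<in> carrier M\<rbrakk> \<Longrightarrow> X (g \<oplus>\<^bsub>M\<^esub> h) = X g \<oplus>\<^bsub>M\<^esub> X h"
    and X_scale: "\<lbrakk>r \<in> carrier R; h \<in> carrier M\<rbrakk> \<Longrightarrow> X (r \<odot>\<^bsub>M\<^esub> h) = (r [^]\<^bsub>R\<^esub> p) \<odot>\<^bsub>M\<^esub> X h"
    and p_ge_2: "2 \<le> p"
begin

lemma X_zero: "X \<zero>\<^bsub>M\<^esub> = \<zero>\<^bsub>M\<^esub>"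
proof -
  have "X (\<zero> \<bullet> \<zero>\<^bsub>M\<^esub>) = (\<zero> [^] p) \<bullet> X \<zero>\<^bsub>M\<^esub>" by (rule X_scale) auto
  then show ?thesis using p_ge_2 X_closed by (simp add: R.nat_pow_zero)
qed

lemma funpow_X_closed: "h \<in> carrier M \<Longrightarrow> (X ^^ n) h \<in> carrier M"
  by (induct n) (auto intro: X_closed)

lemma funpow_X_add:
  "\<lbrakk>g \<in> carrier M; h \<in> carrier M\<rbrakk> \<Longrightarrow> (X ^^ n) (g \<boxplus> h) = (X ^^ n) g \<boxplus> (X ^^ n) h"
  by (induct n) (auto simp: X_add funpow_X_closed)

lemma funpow_X_zero: "(X ^^ n) \<zero>\<^bsub>M\<^esub> = \<zero>\<^bsub>M\<^esub>"
  by (induct n) (auto simp: X_zero)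

lemma funpow_X_scale:
  "\<lbrakk>r \<in> carrier R; h \<in> carrier M\<rbrakk> \<Longrightarrow> (X ^^ n) (r \<bullet> h) = (r [^] (p ^ n)) \<bullet> (X ^^ n) h"
  by (induct n) (auto simp: X_scale funpow_X_closed R.nat_pow_pow mult.commute)

lemma X_limit_scalar:
  assumes b: "b \<in> limit_scalars" and h: "h \<in> carrier M"
  shows "X (b h) = (b ^^ p) (X h)"
proof -
  note Xh = X_closed[OF h]
  define Y where "Y = insert h ((\<lambda>i. (b ^^ i) (X h)) ` {..<p})"
  have "finite Y" "Y \<subseteq> carrier M"
    using h limit_scalar_carrier[OF funpow_limit_scalar[OF b] Xh] by (auto simp: Y_def)
  then obtain r where r: "r \<in> carrier R" "\<And>y. y \<in> Y \<Longrightarrow> b y = r \<bullet> y"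
    using limit_scalar_on_finite[OF b] by blast
  have "i \<le> p \<Longrightarrow> (b ^^ i) (X h) = (r [^] i) \<bullet> X h" for i
  proof (induct i)
    case (Suc i)
    then have "(b ^^ i) (X h) \<in> Y" unfolding Y_def by (intro insertI2 imageI) simp
    then have "b ((b ^^ i) (X h)) = r \<bullet> (b ^^ i) (X h)" by (rule r(2))
    then show ?case using Suc r(1) Xh by (simp add: smult_assoc1[symmetric] m_comm)
  qed (use Xh in simp)
  then have "(b ^^ p) (X h) = (r [^] p) \<bullet> X h" by simp
  also have "\<dots> = X (b h)" using r(2)[of h] X_scale[OF r(1) h] by (simp add: Y_def)
  finally show ?thesis ..
qed

lemma funpow_X_limit_scalar:
  assumes b: "b \<in> limit_scalars" and h: "h \<in> carrier M"
  shows "(X ^^ n) (b h) = (b ^^ (p ^ n)) ((X ^^ n) h)"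
proof (induct n)
  case (Suc n)
  have "(X ^^ Suc n) (b h) = X ((b ^^ (p ^ n)) ((X ^^ n) h))" using Suc by simp
  also have "\<dots> = ((b ^^ (p ^ n)) ^^ p) (X ((X ^^ n) h))"
    by (rule X_limit_scalar[OF funpow_limit_scalar[OF b] funpow_X_closed[OF h]])
  finally show ?case by (simp add: funpow_mult mult.commute)
qed simp

definition stable :: "'c set \<Rightarrow> bool"
  where "stable N \<longleftrightarrow> sub N \<and> (\<forall>h\<in>N. X h \<in> N)"

lemma stable_funpow: "stable N \<Longrightarrow> h \<in> N \<Longrightarrow> (X ^^ n) h \<in> N"
  by (induct n) (auto simp: stable_def)

definition power_kernel :: "'c set \<Rightarrow> nat \<Rightarrow> 'c set"
  where "power_kernel G e = {h \<in> G. (X ^^ e) h = \<zero>\<^bsub>M\<^esub>}"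

definition nilpotent :: "'c set \<Rightarrow> bool"
  where "nilpotent G \<longleftrightarrow> (\<exists>e. \<forall>h\<in>G. (X ^^ e) h = \<zero>\<^bsub>M\<^esub>)"

lemma sub_kernel: "sub G \<Longrightarrow> sub (power_kernel G e)"
  by (rule subI) (auto simp: power_kernel_def funpow_X_add funpow_X_scale funpow_X_zero sub_carrier
      sub_zero intro: sub_add sub_scale)

lemma kernel_mono: "e \<le> n \<Longrightarrow> power_kernel G e \<subseteq> power_kernel G n"
proof
  fix h assume "e \<le> n" "h \<in> power_kernel G e"
  then have "(X ^^ ((n - e) + e)) h = \<zero>\<^bsub>M\<^esub>" "h \<in> G"
    unfolding funpow_add by (simp_all add: power_kernel_def funpow_X_zero)
  then show "h \<in> power_kernel G n" using \<open>e \<le> n\<close> by (simp add: power_kernel_def)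
qed

lemma stable_limit_scalar_image:
  assumes b: "b \<in> limit_scalars" and G: "stable G"
  shows "stable (b ` G)"
  unfolding stable_def
proof (intro conjI ballI)
  have subG: "sub G" using G by (simp add: stable_def)
  then show "sub (b ` G)" by (rule sub_limit_scalar_image[OF b])
  fix u assume "u \<in> b ` G"
  then obtain h where h: "h \<in> G" "u = b h" by blast
  obtain q where q: "p = Suc q" using p_ge_2 by (cases p) auto
  have "X u = b ((b ^^ q) (X h))"
    using X_limit_scalar[OF b sub_carrier[OF subG h(1)]] h(2) by (simp add: q)
  moreover have "(b ^^ q) (X h) \<in> G"
    using limit_scalar_closed[OF funpow_limit_scalar[OF b] subG] G h(1) by (simp add: stable_def)
  ultimately show "X u \<in> b ` G" by blast
qed

text \<open>A minimal counterexample to the nilpotency of a torsion Frobenius action.\<close>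

definition minimal_nonnilpotent :: "'c set \<Rightarrow> bool"
  where "minimal_nonnilpotent G \<longleftrightarrow> stable G \<and> (\<forall>h\<in>G. \<exists>e. (X ^^ e) h = \<zero>\<^bsub>M\<^esub>) \<and> \<not> nilpotent G
    \<and> (\<forall>N. stable N \<longrightarrow> N \<subseteq> G \<longrightarrow> \<not> nilpotent N \<longrightarrow> N = G)"

context
  fixes G
  assumes G: "minimal_nonnilpotent G"
begin

lemma stable_G: "stable G" and sub_G: "sub G" and not_nilpotent_G: "\<not> nilpotent G"
  using G by (auto simp: minimal_nonnilpotent_def stable_def)

lemma torsion_G: "h \<in> G \<Longrightarrow> \<exists>e. h \<in> power_kernel G e"
  using G by (auto simp: minimal_nonnilpotent_def power_kernel_def)

lemma kernel_neq_G: "power_kernel G e \<noteq> G"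
  using not_nilpotent_G by (auto simp: nilpotent_def power_kernel_def)

lemma proper_stable_subset_kernel:
  assumes "stable N" "N \<subseteq> G" "N \<noteq> G"
  obtains e where "N \<subseteq> power_kernel G e"
proof -
  have "nilpotent N" using G assms by (auto simp: minimal_nonnilpotent_def)
  then show thesis using that assms(2) by (fastforce simp: nilpotent_def power_kernel_def)
qed

lemma limit_scalar_image_subset: "b \<in> limit_scalars \<Longrightarrow> b ` G \<subseteq> G"
  using limit_scalar_closed[OF _ sub_G] by blast

text \<open>Minimality gives \<open>X\<^sup>e b = 0\<close> on \<open>G\<close>, that is, \<open>b\<^sup>q X\<^sup>e = 0\<close> with \<open>q = p\<^sup>e\<close>. The elements all of
  whose iterates under \<open>X\<close> are killed by \<open>b\<^sup>q\<close> form a stable submodule containing \<open>X\<^sup>e G\<close>. It is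
  all of \<open>G\<close>, since otherwise \<open>X\<close> would be nilpotent on it and hence on \<open>G\<close>.\<close>

lemma nonsurjective_imp_nilpotent:
  assumes b: "b \<in> limit_scalars" and ns: "b ` G \<noteq> G"
  obtains q where "\<And>h. h \<in> G \<Longrightarrow> (b ^^ q) h = \<zero>\<^bsub>M\<^esub>"
proof -
  obtain e where e: "b ` G \<subseteq> power_kernel G e"
    using proper_stable_subset_kernel[OF stable_limit_scalar_image[OF b stable_G]
        limit_scalar_image_subset[OF b] ns] by blast
  define c where "c = b ^^ (p ^ e)"
  have c: "c \<in> limit_scalars" unfolding c_def by (rule funpow_limit_scalar[OF b])
  have cX: "c ((X ^^ e) h) = \<zero>\<^bsub>M\<^esub>" if "h \<in> G" for h
    using e that funpow_X_limit_scalar[OF b sub_carrier[OF sub_G that], of e]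
    by (auto simp: power_kernel_def c_def)
  define W where "W = {h \<in> G. \<forall>j. c ((X ^^ j) h) = \<zero>\<^bsub>M\<^esub>}"
  have "stable W"
    unfolding stable_def
  proof
    show "sub W"
      by (rule subI)
        (auto simp: W_def funpow_X_add funpow_X_scale funpow_X_zero funpow_X_closed
          limit_scalar_add[OF c] limit_scalar_scale[OF c] limit_scalar_zero[OF c]
          sub_carrier[OF sub_G] intro: sub_zero[OF sub_G] sub_add[OF sub_G] sub_scale[OF sub_G])
    have "c ((X ^^ j) (X h)) = \<zero>\<^bsub>M\<^esub>" if "h \<in> W" for h j
    proof -
      have "(X ^^ j) (X h) = (X ^^ Suc j) h" by (simp add: funpow_swap1)
      then show ?thesis using that unfolding W_def by (metis (mono_tags, lifting) mem_Collect_eq)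
    qed
    then show "\<forall>h\<in>W. X h \<in> W" using stable_G by (auto simp: W_def stable_def)
  qed
  moreover have XW: "(X ^^ e) h \<in> W" if "h \<in> G" for h
  proof -
    have "c ((X ^^ j) ((X ^^ e) h)) = \<zero>\<^bsub>M\<^esub>" for j
    proof -
      have "(X ^^ j) ((X ^^ e) h) = (X ^^ e) ((X ^^ j) h)"
        by (metis add.commute comp_apply funpow_add)
      then show ?thesis using cX stable_funpow[OF stable_G that] by simp
    qed
    then show ?thesis using stable_funpow[OF stable_G that] by (simp add: W_def)
  qed
  ultimately have "W = G"
  proof (rule_tac ccontr)
    assume "stable W" and "W \<noteq> G"
    then obtain n where n: "W \<subseteq> power_kernel G n"
      using proper_stable_subset_kernel[of W] by (auto simp: W_def)
    have "(X ^^ (n + e)) h = \<zero>\<^bsub>M\<^esub>" if "h \<in> G" for h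
      using n XW[OF that] by (auto simp: funpow_add power_kernel_def)
    then show False using not_nilpotent_G unfolding nilpotent_def by blast
  qed
  then have "(b ^^ (p ^ e)) h = \<zero>\<^bsub>M\<^esub>" if "h \<in> G" for h
    using that unfolding W_def c_def by (metis (mono_tags, lifting) funpow_0 mem_Collect_eq)
  then show thesis using that by blast
qed

text \<open>The submodule \<open>E\<close> generated by the images \<open>b G \<noteq> G\<close> is stable, so it suffices that \<open>E \<noteq> G\<close>. If
  \<open>E = G\<close>, choose \<open>c\<close> with \<open>N = c G\<close> nonzero and minimal. Some nonsurjective \<open>b\<close> satisfies
  \<open>b c G \<noteq> 0\<close>, because otherwise \<open>c\<close> would kill all images \<open>b G\<close> and thus \<open>G\<close>. By minimality
  \<open>b N = N\<close>, which is impossible for a nilpotent \<open>b\<close>.\<close>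

lemma nonsurjective_images_bounded:
  obtains e where "\<And>b. \<lbrakk>b \<in> limit_scalars; b ` G \<noteq> G\<rbrakk> \<Longrightarrow> b ` G \<subseteq> power_kernel G e"
proof -
  define \<F> where "\<F> = {N. sub N \<and> N \<subseteq> G \<and> (\<forall>b\<in>limit_scalars. b ` G \<noteq> G \<longrightarrow> b ` G \<subseteq> N)}"
  define E where "E = \<Inter>\<F>"
  have GF: "G \<in> \<F>" using sub_G limit_scalar_image_subset by (auto simp: \<F>_def)
  have EG: "E \<subseteq> G" using GF by (auto simp: E_def)
  have bE: "b ` G \<subseteq> E" if "b \<in> limit_scalars" "b ` G \<noteq> G" for b
    using that unfolding E_def \<F>_def by blast
  have Fsub: "sub N" if "N \<in> \<F>" for N using that by (simp add: \<F>_def)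
  have subE: "sub E"
    by (rule subI) (use EG sub_carrier[OF sub_G] Fsub in
        \<open>auto simp: E_def intro: sub_zero sub_add sub_scale\<close>)
  have stE: "stable E"
  proof -
    have "{h \<in> E. X h \<in> E} \<in> \<F>"
      unfolding \<F>_def mem_Collect_eq
    proof (intro conjI ballI impI)
      show "sub {h \<in> E. X h \<in> E}"
        by (rule subI) (auto simp: X_add X_scale X_zero sub_carrier[OF subE]
            intro: sub_zero[OF subE] sub_add[OF subE] sub_scale[OF subE])
      show "{h \<in> E. X h \<in> E} \<subseteq> G" using EG by blast
      fix b assume b: "b \<in> limit_scalars" "b ` G \<noteq> G"
      then show "b ` G \<subseteq> {h \<in> E. X h \<in> E}"
        using bE[OF b] stable_limit_scalar_image[OF b(1) stable_G] unfolding stable_def by blast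
    qed
    then have "E \<subseteq> {h \<in> E. X h \<in> E}" unfolding E_def by blast
    then show ?thesis using subE unfolding stable_def by blast
  qed
  have "E \<noteq> G"
  proof
    assume E_eq: "E = G"
    \<comment> \<open>The descending chain condition is applied to the nonzero images of \<open>G\<close>.\<close>
    define P where "P N \<longleftrightarrow> (\<exists>c\<in>limit_scalars. N = c ` G \<and> N \<noteq> {\<zero>\<^bsub>M\<^esub>})" for N
    have "G \<noteq> {\<zero>\<^bsub>M\<^esub>}" using not_nilpotent_G funpow_X_zero by (auto simp: nilpotent_def)
    then have PG: "P G" unfolding P_def by (intro bexI[of _ id] id_limit_scalar) simp
    have P_sub: "sub L" if "P L" for L
      using that sub_limit_scalar_image[OF _ sub_G] by (auto simp: P_def)
    obtain N where "P N" and min: "\<And>L. P L \<Longrightarrow> L \<subseteq> N \<Longrightarrow> L = N"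
      using minimal_submodule[of P, OF PG P_sub] by blast
    then obtain c where c: "c \<in> limit_scalars" "N = c ` G" "N \<noteq> {\<zero>\<^bsub>M\<^esub>}"
      unfolding P_def by blast
    have subN: "sub N" using sub_limit_scalar_image[OF c(1) sub_G] c(2) by simp
    have NG: "N \<subseteq> G" using limit_scalar_image_subset[OF c(1)] c(2) by simp
    have "\<exists>b\<in>limit_scalars. b ` G \<noteq> G \<and> b ` N \<noteq> {\<zero>\<^bsub>M\<^esub>}"
    proof (rule ccontr)
      assume none: "\<not> ?thesis"
      have "{h \<in> G. c h \<in> {\<zero>\<^bsub>M\<^esub>}} \<in> \<F>"
        unfolding \<F>_def mem_Collect_eq
      proof (intro conjI ballI impI)
        show "sub {h \<in> G. c h \<in> {\<zero>\<^bsub>M\<^esub>}}"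
          by (rule sub_limit_scalar_preimage[OF c(1) sub_G sub_singleton_zero])
        fix b assume b: "b \<in> limit_scalars" "b ` G \<noteq> G"
        then have bN: "b ` N = {\<zero>\<^bsub>M\<^esub>}" using none by blast
        show "b ` G \<subseteq> {h \<in> G. c h \<in> {\<zero>\<^bsub>M\<^esub>}}"
        proof (rule image_subsetI, rule CollectI, rule conjI)
          fix h assume h: "h \<in> G"
          show "b h \<in> G" by (rule limit_scalar_closed[OF b(1) sub_G h])
          have "b (c h) \<in> b ` N" unfolding c(2) using h by (intro imageI)
          then show "c (b h) \<in> {\<zero>\<^bsub>M\<^esub>}"
            using bN limit_scalar_commute[OF b(1) c(1) sub_carrier[OF sub_G h]] by simp
        qed
      qed blast
      then have "E \<subseteq> {h \<in> G. c h \<in> {\<zero>\<^bsub>M\<^esub>}}" unfolding E_def by (rule Inter_lower)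
      then have "G \<subseteq> {h \<in> G. c h \<in> {\<zero>\<^bsub>M\<^esub>}}" using E_eq by simp
      then have "N \<subseteq> {\<zero>\<^bsub>M\<^esub>}" unfolding c(2) by blast
      then show False using c(3) sub_zero[OF subN] by blast
    qed
    then obtain b where b: "b \<in> limit_scalars" "b ` G \<noteq> G" "b ` N \<noteq> {\<zero>\<^bsub>M\<^esub>}" by blast
    have "b ` N = (b \<circ> c) ` G" unfolding c(2) by (simp add: image_comp)
    then have "P (b ` N)" using comp_limit_scalar[OF b(1) c(1)] b(3) unfolding P_def by blast
    then have bN: "b ` N = N" using min limit_scalar_closed[OF b(1) subN] by blast
    have powN: "(b ^^ i) ` N = N" for i
    proof (induct i)
      case (Suc i)
      have "(b ^^ Suc i) ` N = b ` (b ^^ i) ` N" by (simp add: image_comp)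
      then show ?case using Suc bN by simp
    qed simp
    obtain q where "\<And>h. h \<in> G \<Longrightarrow> (b ^^ q) h = \<zero>\<^bsub>M\<^esub>"
      using nonsurjective_imp_nilpotent[OF b(1,2)] by blast
    then have "N \<subseteq> {\<zero>\<^bsub>M\<^esub>}" using powN[of q] NG by force
    then show False using c(3) sub_zero[OF subN] by blast
  qed
  then obtain e where "E \<subseteq> power_kernel G e" using proper_stable_subset_kernel[OF stE EG] by blast
  then show thesis using that bE by blast
qed

text \<open>By induction on \<open>n\<close>, \<open>b\<^sup>2\<close> maps \<open>K\<^bsub>n+e\<^esub>\<close> into \<open>K\<^sub>e\<close>: if \<open>b\<^sup>2 X h \<in> K\<^sub>e\<close>, then
  \<open>X (b h) = b\<^sup>p X h \<in> K\<^sub>e\<close>, so \<open>b h \<in> K\<^bsub>e+1\<^esub>\<close> and \<open>b\<^sup>2 h \<in> K\<^sub>e\<close>. Hence \<open>b\<^sup>2 G \<subseteq> K\<^sub>e \<noteq> G\<close>.\<close>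

lemma kernel_shift_imp_nonsurjective:
  assumes b: "b \<in> limit_scalars" and shift: "\<And>h. h \<in> power_kernel G (Suc e) \<Longrightarrow> b h \<in> power_kernel G e"
  shows "b ` G \<noteq> G"
proof
  assume surj: "b ` G = G"
  note subK = sub_kernel[OF sub_G]
  have *: "b (b h) \<in> power_kernel G e" if "h \<in> power_kernel G (n + e)" for n h
    using that
  proof (induct n arbitrary: h)
    case 0
    then show ?case using limit_scalar_closed[OF b subK] by simp
  next
    case (Suc n)
    then have hG: "h \<in> G" by (simp add: power_kernel_def)
    have "(X ^^ (n + e)) (X h) = \<zero>\<^bsub>M\<^esub>" using Suc.prems by (simp add: power_kernel_def funpow_swap1)
    then have "X h \<in> power_kernel G (n + e)" using stable_G hG by (simp add: power_kernel_def stable_def)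
    then have 1: "b (b (X h)) \<in> power_kernel G e" by (rule Suc.hyps)
    obtain q where q: "p = q + 2" using p_ge_2 by (metis add.commute le_Suc_ex)
    have "X (b h) = (b ^^ q) (b (b (X h)))"
      using X_limit_scalar[OF b sub_carrier[OF sub_G hG]] by (simp add: q funpow_add funpow_swap1 numeral_2_eq_2)
    then have "X (b h) \<in> power_kernel G e"
      using limit_scalar_closed[OF funpow_limit_scalar[OF b] subK 1] by simp
    then have "b h \<in> power_kernel G (Suc e)"
      using limit_scalar_closed[OF b sub_G hG] by (simp add: power_kernel_def funpow_swap1)
    then show ?case by (rule shift)
  qed
  have "G \<subseteq> power_kernel G e"
  proof
    fix h assume "h \<in> G"
    then obtain g where g: "g \<in> G" "h = b (b g)" using surj by (metis imageE)
    then obtain n where "g \<in> power_kernel G n" using torsion_G by blast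
    then have "g \<in> power_kernel G (n + e)" using kernel_mono[of n "n + e"] by auto
    then show "h \<in> power_kernel G e" using * g(2) by simp
  qed
  then show False using kernel_neq_G[of e] by (auto simp: power_kernel_def)
qed

text \<open>Climb from \<open>K\<^sub>e\<close>, which contains all images of nonsurjective operators, to \<open>G\<close> along a filtration
  with simple socles, and show for each member \<open>F\<close> that large \<open>n\<close> admit a surjective operator
  mapping \<open>K\<^bsub>n+1\<^esub> \<inter> F\<close> into \<open>K\<^sub>n\<close>. For a step \<open>F \<subseteq> C\<close> consider the chain
  \<open>F + (K\<^sub>n \<inter> C)\<close>. Either it reaches \<open>C\<close>, and the operator for \<open>F\<close> works for \<open>C\<close>; or an operator \<open>c\<close>
  maps its \<open>(n+1)\<close>-st member, but not \<open>C\<close>, into \<open>F\<close>, and \<open>c\<close> followed by the operator for \<open>F\<close> works.\<close>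

lemma kernel_shift_exists:
  "\<exists>n\<^sub>0. \<forall>n\<ge>n\<^sub>0. \<exists>b\<in>limit_scalars. b ` G = G \<and> (\<forall>h\<in>power_kernel G (Suc n). b h \<in> power_kernel G n)"
proof -
  note subK = sub_kernel[OF sub_G]
  obtain e where e: "\<And>b. \<lbrakk>b \<in> limit_scalars; b ` G \<noteq> G\<rbrakk> \<Longrightarrow> b ` G \<subseteq> power_kernel G e"
    using nonsurjective_images_bounded by blast
  define Q where "Q F \<longleftrightarrow> (\<exists>n\<^sub>0. \<forall>n\<ge>n\<^sub>0. \<exists>b\<in>limit_scalars. b ` G = G
    \<and> (\<forall>h\<in>power_kernel G (Suc n) \<inter> F. b h \<in> power_kernel G n))" for F
  have "Q G"
  proof (rule simple_socle_induct[where Q = Q, OF subK sub_G])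
    show "power_kernel G e \<subseteq> G" by (auto simp: power_kernel_def)
    have "\<exists>b\<in>limit_scalars. b ` G = G \<and> (\<forall>h\<in>power_kernel G (Suc n) \<inter> power_kernel G e. b h \<in> power_kernel G n)"
      if "e \<le> n" for n
      using kernel_mono[OF that] by (intro bexI[of _ id] id_limit_scalar) auto
    then show "Q (power_kernel G e)" unfolding Q_def by blast
  next
    fix F C assume F: "sub F" and C: "sub C" and eF: "power_kernel G e \<subseteq> F" and FC: "F \<subseteq> C" and CG: "C \<subseteq> G"
      and soc: "simple_socle F C" and QF: "Q F"
    obtain n\<^sub>0 where n0: "\<And>n. n \<ge> n\<^sub>0 \<Longrightarrow> \<exists>b\<in>limit_scalars. b ` G = G
        \<and> (\<forall>h\<in>power_kernel G (Suc n) \<inter> F. b h \<in> power_kernel G n)"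
      using QF unfolding Q_def by blast
    define N where "N n = {f \<boxplus> k | f k. f \<in> F \<and> k \<in> power_kernel G n \<inter> C}" for n
    have subN: "sub (N n)" for n
      unfolding N_def by (rule sub_sum[OF F sub_Int[OF subK C]])
    have FN: "F \<subseteq> N n" for n
    proof
      fix f assume f: "f \<in> F"
      then have "f = f \<boxplus> \<zero>\<^bsub>M\<^esub>" using sub_carrier[OF F] by simp
      then show "f \<in> N n" unfolding N_def using f sub_zero[OF sub_Int[OF subK C]] by blast
    qed
    have KN: "power_kernel G n \<inter> C \<subseteq> N n" for n
    proof
      fix k assume k: "k \<in> power_kernel G n \<inter> C"
      then have "k = \<zero>\<^bsub>M\<^esub> \<boxplus> k" using sub_carrier[OF C] by simp
      then show "k \<in> N n" unfolding N_def using k sub_zero[OF F] by blast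
    qed
    have NC: "N n \<subseteq> C" for n
      unfolding N_def using FC sub_add[OF C] by blast
    show "Q C"
    proof (cases "\<exists>n\<^sub>1. N n\<^sub>1 = C")
      case True
      then obtain n\<^sub>1 where n1: "N n\<^sub>1 = C" ..
      have "\<exists>b\<in>limit_scalars. b ` G = G \<and> (\<forall>h\<in>power_kernel G (Suc n) \<inter> C. b h \<in> power_kernel G n)"
        if n: "n \<ge> max n\<^sub>0 n\<^sub>1" for n
      proof -
        obtain b where b: "b \<in> limit_scalars" "b ` G = G"
          and bF: "\<And>h. h \<in> power_kernel G (Suc n) \<inter> F \<Longrightarrow> b h \<in> power_kernel G n"
          using n0[of n] n by auto
        have "b h \<in> power_kernel G n" if h: "h \<in> power_kernel G (Suc n) \<inter> C" for h
        proof -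
          have "h \<in> N n\<^sub>1" using h n1 by blast
          then obtain f k where fk: "f \<in> F" "k \<in> power_kernel G n\<^sub>1" "h = f \<boxplus> k" unfolding N_def by blast
          have k: "k \<in> power_kernel G n" using fk(2) kernel_mono[of n\<^sub>1 n] n by auto
          then have k': "k \<in> power_kernel G (Suc n)" using kernel_mono[of n "Suc n"] by auto
          note fc = sub_carrier[OF F fk(1)] and kc = sub_carrier[OF subK k]
          have "k \<boxplus> f \<in> power_kernel G (Suc n)" using h fk(3) fc kc by (simp add: M.a_comm)
          then have "f \<in> power_kernel G (Suc n)" by (rule sub_add_cancel[OF subK k' fc])
          then have "b f \<in> power_kernel G n" using bF fk(1) by blast
          moreover have "b k \<in> power_kernel G n" by (rule limit_scalar_closed[OF b(1) subK k])
          ultimately show ?thesis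
            using limit_scalar_add[OF b(1) fc kc] fk(3) sub_add[OF subK] by simp
        qed
        then show ?thesis using b by blast
      qed
      then show ?thesis unfolding Q_def by blast
    next
      case False
      have "\<exists>b\<in>limit_scalars. b ` G = G \<and> (\<forall>h\<in>power_kernel G (Suc n) \<inter> C. b h \<in> power_kernel G n)"
        if n: "n \<ge> n\<^sub>0" for n
      proof -
        obtain b where b: "b \<in> limit_scalars" "b ` G = G"
          and bF: "\<And>h. h \<in> power_kernel G (Suc n) \<inter> F \<Longrightarrow> b h \<in> power_kernel G n"
          using n0[OF n] by auto
        obtain h\<^sub>1 where h1: "h\<^sub>1 \<in> C" "h\<^sub>1 \<notin> N (Suc n)" using False NC by blast
        obtain c where c: "c \<in> limit_scalars" and cN: "\<And>y. y \<in> N (Suc n) \<Longrightarrow> c y \<in> F"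
          and ch1: "c h\<^sub>1 \<notin> F"
          using separation[OF F C soc subN FN NC h1] by blast
        \<comment> \<open>A nonsurjective operator would map \<open>C\<close> into \<open>K\<^sub>e\<close> and hence into \<open>F\<close>.\<close>
        have cG: "c ` G = G" using e[OF c] ch1 h1(1) CG eF by blast
        have "(b \<circ> c) ` G = b ` c ` G" by (rule image_comp[symmetric])
        then have "(b \<circ> c) ` G = G" using b(2) cG by simp
        moreover have "(b \<circ> c) h \<in> power_kernel G n" if h: "h \<in> power_kernel G (Suc n) \<inter> C" for h
        proof -
          have "c h \<in> F" using cN KN h by blast
          moreover have "c h \<in> power_kernel G (Suc n)" using limit_scalar_closed[OF c subK] h by blast
          ultimately show ?thesis using bF by simp
        qed
        ultimately show ?thesis using comp_limit_scalar[OF b(1) c] by blast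
      qed
      then show ?thesis unfolding Q_def by blast
    qed
  qed
  moreover have "power_kernel G n \<inter> G = power_kernel G n" for n by (auto simp: power_kernel_def)
  ultimately show ?thesis unfolding Q_def by simp
qed

lemma no_minimal_nonnilpotent: False
proof -
  obtain n b where "b \<in> limit_scalars" "b ` G = G" "\<forall>h\<in>power_kernel G (Suc n). b h \<in> power_kernel G n"
    using kernel_shift_exists by blast
  then show False using kernel_shift_imp_nonsurjective[of b n] by simp
qed

end

theorem torsion_imp_nilpotent:
  assumes st: "stable G" and tors: "\<And>h. h \<in> G \<Longrightarrow> \<exists>e. (X ^^ e) h = \<zero>\<^bsub>M\<^esub>"
  shows "nilpotent G"
proof (rule ccontr)
  assume nn: "\<not> nilpotent G"
  define P where "P N \<longleftrightarrow> stable N \<and> N \<subseteq> G \<and> \<not> nilpotent N" for N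
  have "P G" using st nn by (simp add: P_def)
  then obtain N where N: "P N" and min: "\<And>L. P L \<Longrightarrow> L \<subseteq> N \<Longrightarrow> L = N"
    using minimal_submodule[of P G] unfolding P_def stable_def by blast
  have "minimal_nonnilpotent N"
    using N min tors unfolding minimal_nonnilpotent_def P_def by blast
  then show False by (rule no_minimal_nonnilpotent)
qed

end

theorem theorem2p6:
  fixes R :: "('a, 'b) ring_scheme"
    and m :: "'a set"
    and p :: nat
    and H :: "(nat \<Rightarrow> 'a, 'h, 'c) module_scheme"
  assumes "local_ring R m"
    and "noetherian_ring R"
    and "prime p"
    and "ring_char R = p"
    and "left_module (frobenius_skew_ring R p) H"
    and "artinian_module R (restrict_scalars (skew_const R) H)"
  shows "\<exists>e::nat. (\<lambda>h. (skew_var R [^]\<^bsub>frobenius_skew_ring R p\<^esub> e) \<odot>\<^bsub>H\<^esub> h) ` x_torsion R p H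
      = {\<zero>\<^bsub>H\<^esub>}"
proof -
  let ?S = "frobenius_skew_ring R p"
  let ?M = "restrict_scalars (skew_const R) H"
  let ?x = "skew_var R"
  define X where "X h = ?x \<odot>\<^bsub>H\<^esub> h" for h
  have cring: "cring R" using assms(1) by (simp add: local_ring_def)
  interpret R: cring R by (rule cring)
  interpret H: left_module ?S H by fact
  have M_sel: "carrier ?M = carrier H" "\<zero>\<^bsub>?M\<^esub> = \<zero>\<^bsub>H\<^esub>" "g \<oplus>\<^bsub>?M\<^esub> h = g \<oplus>\<^bsub>H\<^esub> h"
    "r \<odot>\<^bsub>?M\<^esub> h = skew_const R r \<odot>\<^bsub>H\<^esub> h" for g h r
    by (simp_all add: restrict_scalars_def)
  have x: "?x \<in> carrier ?S"
    unfolding skew_var_def frobenius_skew_ring_def by (rule R.skew_monom_closed) simp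
  interpret F: frobenius_module R ?M m X p
  proof (intro frobenius_module.intro artinian_local_module.intro
      artinian_local_module_axioms.intro frobenius_module_axioms.intro assms)
    show "2 \<le> p" using assms(3) by (rule prime_ge_2_nat)
    show "X (r \<odot>\<^bsub>?M\<^esub> h) = (r [^]\<^bsub>R\<^esub> p) \<odot>\<^bsub>?M\<^esub> X h" if "r \<in> carrier R" "h \<in> carrier ?M" for r h
      using frobenius_action[OF cring assms(3,4,5) that(1)] that(2) by (simp add: M_sel X_def)
  qed (auto simp: M_sel X_def x H.smult_closed H.smult_r_distr)
  have pow: "(?x [^]\<^bsub>?S\<^esub> n) \<odot>\<^bsub>H\<^esub> h = (X ^^ n) h" if "h \<in> carrier H" for n h
    using that
  proof (induct n arbitrary: h)
    case (Suc n)
    have "(?x [^]\<^bsub>?S\<^esub> Suc n) \<odot>\<^bsub>H\<^esub> h = (?x [^]\<^bsub>?S\<^esub> n) \<odot>\<^bsub>H\<^esub> X h"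
      using Suc.prems x by (simp add: X_def H.smult_assoc1)
    also have "\<dots> = (X ^^ n) (X h)"
      using Suc.prems x by (intro Suc.hyps) (simp add: X_def H.smult_closed)
    finally show ?case by (simp add: funpow_swap1)
  qed (simp add: H.smult_one)
  define \<Gamma> where "\<Gamma> = {h \<in> carrier H. \<exists>j>0. (X ^^ j) h = \<zero>\<^bsub>H\<^esub>}"
  have \<Gamma>: "x_torsion R p H = \<Gamma>"
    unfolding x_torsion_def \<Gamma>_def using pow by auto
  have "F.stable \<Gamma>"
    unfolding F.stable_def
  proof
    show "submodule \<Gamma> R ?M"
    proof (rule F.subI)
      show "\<zero>\<^bsub>?M\<^esub> \<in> \<Gamma>" using F.funpow_X_zero by (auto simp: \<Gamma>_def M_sel)
      fix g h assume "g \<in> \<Gamma>" "h \<in> \<Gamma>"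
      then obtain i j where ij: "i > 0" "g \<in> carrier H" "h \<in> carrier H"
        "g \<in> F.power_kernel (carrier H) i" "h \<in> F.power_kernel (carrier H) j"
        unfolding \<Gamma>_def F.power_kernel_def by (auto simp: M_sel)
      then have "g \<in> F.power_kernel (carrier H) (i + j)" "h \<in> F.power_kernel (carrier H) (i + j)"
        using F.kernel_mono[of i "i + j"] F.kernel_mono[of j "i + j"] by auto
      then have "g \<oplus>\<^bsub>?M\<^esub> h \<in> F.power_kernel (carrier ?M) (i + j)"
        using F.sub_add[OF F.sub_kernel[OF F.carrier_is_submodule]] by (simp add: M_sel)
      then have "g \<oplus>\<^bsub>?M\<^esub> h \<in> carrier H" "(X ^^ (i + j)) (g \<oplus>\<^bsub>?M\<^esub> h) = \<zero>\<^bsub>H\<^esub>"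
        by (simp_all add: F.power_kernel_def M_sel)
      then show "g \<oplus>\<^bsub>?M\<^esub> h \<in> \<Gamma>"
        unfolding \<Gamma>_def using ij(1) by (intro CollectI conjI exI[of _ "i + j"]) simp_all
    next
      fix r h assume r: "r \<in> carrier R" and "h \<in> \<Gamma>"
      then obtain j where "j > 0" "h \<in> F.power_kernel (carrier ?M) j"
        unfolding \<Gamma>_def F.power_kernel_def by (auto simp: M_sel)
      moreover from this have "r \<odot>\<^bsub>?M\<^esub> h \<in> F.power_kernel (carrier ?M) j"
        using F.sub_scale[OF F.sub_kernel[OF F.carrier_is_submodule] r] by blast
      then have "r \<odot>\<^bsub>?M\<^esub> h \<in> carrier H" "(X ^^ j) (r \<odot>\<^bsub>?M\<^esub> h) = \<zero>\<^bsub>H\<^esub>"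
        by (simp_all add: F.power_kernel_def M_sel)
      ultimately show "r \<odot>\<^bsub>?M\<^esub> h \<in> \<Gamma>"
        unfolding \<Gamma>_def by (intro CollectI conjI exI[of _ j]) simp_all
    qed (auto simp: \<Gamma>_def M_sel)
    show "\<forall>h\<in>\<Gamma>. X h \<in> \<Gamma>"
    proof
      fix h assume "h \<in> \<Gamma>"
      then obtain j where j: "h \<in> carrier H" "j > 0" "(X ^^ j) h = \<zero>\<^bsub>H\<^esub>" by (auto simp: \<Gamma>_def)
      have "(X ^^ j) (X h) = \<zero>\<^bsub>H\<^esub>"
        using j(3) F.X_zero by (simp add: funpow_swap1[symmetric] M_sel)
      then show "X h \<in> \<Gamma>" using j F.X_closed[of h] by (auto simp: \<Gamma>_def M_sel)
    qed
  qed
  then have "F.nilpotent \<Gamma>"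
    by (rule F.torsion_imp_nilpotent) (auto simp: \<Gamma>_def M_sel)
  then obtain e where e: "\<And>h. h \<in> \<Gamma> \<Longrightarrow> (X ^^ e) h = \<zero>\<^bsub>H\<^esub>"
    unfolding F.nilpotent_def by (auto simp: M_sel)
  have z: "\<zero>\<^bsub>H\<^esub> \<in> \<Gamma>" using F.funpow_X_zero by (auto simp: \<Gamma>_def M_sel)
  have "(?x [^]\<^bsub>?S\<^esub> e) \<odot>\<^bsub>H\<^esub> h = \<zero>\<^bsub>H\<^esub>" if "h \<in> \<Gamma>" for h
    using pow[of h e] e[OF that] that by (simp add: \<Gamma>_def)
  then have "(\<lambda>h. (?x [^]\<^bsub>?S\<^esub> e) \<odot>\<^bsub>H\<^esub> h) ` x_torsion R p H = {\<zero>\<^bsub>H\<^esub>}"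
    unfolding \<Gamma> using z by auto
  then show ?thesis ..
qed

end
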